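(* Let $V$ be a finite set with $|V|\geq 2$. Consider one of the following three particle systems on $E^V$, with generator $L$ defined in the context: $\mathrm{IRW}$ ($E=\mathbb N$, $v(n)=1$); $\mathrm{SIP}(\alpha)$ with $\alpha>0$ ($E=\mathbb N$, $v(n)=\alpha+n$); $\mathrm{SEP}(\gamma)$ with $\gamma\in\mathbb N$, $\gamma\ge 1$ ($E=\{0,\dots,\gamma\}$, $v(n)=\gamma-n$). Let $d:E\times E\to\mathbb R$ satisfy $d(0,\cdot)\equiv 1$. Then $D(\xi,\eta)=\prod_{x\in V}d(\xi_x,\eta_x)$ is a self-duality function for the system if and only if there exist $a,b\in\mathbb R$ such that, for all $k,n\in E$, $d(k,n)$ has the following form (with the convention $0^0=1$). (1) $\mathrm{IRW}$: if $a=0$, $d(k,n)=\frac{n!}{(n-k)!}\,b^k\,\mathbf 1\{k\le n\}$; if $a\ne0$, $$d(k,n)=a^k\sum_{r=0}^{\min(k,n)}\binom nr\binom kr r!\left(\frac ba\right)^r .$$ (2) $\mathrm{SIP}(\alpha)$: if $a=0$, $d(k,n)=\frac{n!}{(n-k)!}\frac{\Gamma(\alpha)}{\Gamma(\alpha+k)}(b\alpha)^k\,\mathbf 1\{k\le n\}$; if $a\neq 0$, $$d(k,n)=a^k\;{}_2F_1\!\left(-n,-k;\alpha;\tfrac{b\alpha}{a}\right).$$ (3) $\mathrm{SEP}(\gamma)$: if $a=0$, $d(k,n)=\frac{(\gamma-k)!}{\gamma!}\frac{n!}{(n-k)!}(b\gamma)^k\,\mathbf 1\{k\le n\}$; if $a\ne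 0$, $$d(k,n)=a^k\;{}_2F_1\!\left(-n,-k;-\gamma;-\tfrac{b\gamma}{a}\right).$$
   Context: Let $p:V\times V\to[0,\infty)$ satisfy $p(x,x)=0$ for all $x$ and irreducibility: for all $x,y\in V$ there exist $x_1=x,x_2,\dots,x_m=y$ with $\prod_{l=1}^{m-1}p(x_l,x_{l+1})>0$. The generator is $Lf(\eta)=\sum_{x,y\in V}p(x,y)L_{x,y}f(\eta)$, $\eta\in E^V$, with $$L_{x,y}f(\eta)=\eta_x v(\eta_y)(f(\eta^{x,y})-f(\eta))+\eta_y v(\eta_x)(f(\eta^{y,x})-f(\eta)),$$ where $\eta^{x,y}$ is $\eta$ with one particle moved from $x$ to $y$ (terms with zero rate vanish). $D:E^V\times E^V\to\mathbb R$ is a self-duality function if $\mathbb E_\xi D(\xi(t),\eta)=\mathbb E_\eta D(\xi,\eta(t))$ for all $t>0$ and all $\xi,\eta\in E^V$, both processes evolving with generator $L$. Here ${}_2F_1(-n,-k;c;w)=\sum_{r=0}^{\min(k,n)}\frac{(-n)_r(-k)_r}{(c)_r}\frac{w^r}{r!}$, with $(c)_r=c(c+1)\cdots(c+r-1)$; for $c=-\gamma$ and $k,n\le\gamma$ all denominators are nonzero. *)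

theory Defs
  imports "HOL-Probability.Probability"
begin

definition move :: "('v \<Rightarrow> nat) \<Rightarrow> 'v \<Rightarrow> 'v \<Rightarrow> 'v \<Rightarrow> nat" where
  "move \<eta> x y = (let \<zeta> = \<eta>(x := \<eta> x - 1) in \<zeta>(y := \<zeta> y + 1))"

(* If \<eta> x = 0, or if site y is full in SEP, move \<eta> x y is not a meaningful configuration,
   but it only occurs multiplied by a zero rate. *)
definition bond_generator ::
  "(nat \<Rightarrow> real) \<Rightarrow> 'v \<Rightarrow> 'v \<Rightarrow> (('v \<Rightarrow> nat) \<Rightarrow> real) \<Rightarrow> ('v \<Rightarrow> nat) \<Rightarrow> real" where
  "bond_generator v x y f \<eta> =
     real (\<eta> x) * v (\<eta> y) * (f (move \<eta> x y) - f \<eta>) +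
     real (\<eta> y) * v (\<eta> x) * (f (move \<eta> y x) - f \<eta>)"

definition generator ::
  "('v::finite \<Rightarrow> 'v \<Rightarrow> real) \<Rightarrow> (nat \<Rightarrow> real) \<Rightarrow> (('v \<Rightarrow> nat) \<Rightarrow> real) \<Rightarrow> ('v \<Rightarrow> nat) \<Rightarrow> real" where
  "generator p v f \<eta> = (\<Sum>x\<in>UNIV. \<Sum>y\<in>UNIV. p x y * bond_generator v x y f \<eta>)"

definition irreducible_rates :: "('v \<Rightarrow> 'v \<Rightarrow> real) \<Rightarrow> bool" where
  "irreducible_rates p \<longleftrightarrow>
     (\<forall>x y. \<exists>xs. xs \<noteq> [] \<and> hd xs = x \<and> last xs = y \<and>
        (\<Prod>l<length xs - 1. p (xs ! l) (xs ! Suc l)) > 0)"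

(* P t \<xi> is the law at time t, on the state space S, of the Markov process started from \<xi>.
   The generator is the pointwise right derivative at time 0, tested on bounded functions.
   Since the dynamics conserves the number of particles, the states reachable from a given one
   are finitely many, so that the generators considered here determine P on S. *)
definition markov_process ::
  "'s set \<Rightarrow> (('s \<Rightarrow> real) \<Rightarrow> 's \<Rightarrow> real) \<Rightarrow> (real \<Rightarrow> 's \<Rightarrow> 's pmf) \<Rightarrow> bool" where
  "markov_process S L P \<longleftrightarrow>
     (\<forall>\<xi>\<in>S. P 0 \<xi> = return_pmf \<xi>) \<and>
     (\<forall>t\<ge>0. \<forall>\<xi>\<in>S. set_pmf (P t \<xi>) \<subseteq> S) \<and>
     (\<forall>s\<ge>0. \<forall>t\<ge>0. \<forall>\<xi>\<in>S. P (s + t) \<xi> = bind_pmf (P s \<xi>) (P t)) \<and>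
     (\<forall>f. bounded (range f) \<longrightarrow>
        (\<forall>\<xi>\<in>S. ((\<lambda>t. (measure_pmf.expectation (P t \<xi>) f - f \<xi>) / t) \<longlongrightarrow> L f \<xi>) (at_right 0)))"

definition self_duality_function ::
  "'s set \<Rightarrow> (real \<Rightarrow> 's \<Rightarrow> 's pmf) \<Rightarrow> ('s \<Rightarrow> 's \<Rightarrow> real) \<Rightarrow> bool" where
  "self_duality_function S P D \<longleftrightarrow>
     (\<forall>t>0. \<forall>\<xi>\<in>S. \<forall>\<eta>\<in>S.
        measure_pmf.expectation (P t \<xi>) (\<lambda>\<zeta>. D \<zeta> \<eta>) =
        measure_pmf.expectation (P t \<eta>) (\<lambda>\<zeta>. D \<xi> \<zeta>))"

datatype particle_system = IRW | SIP real | SEP nat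

fun admissible :: "particle_system \<Rightarrow> bool" where
  "admissible IRW \<longleftrightarrow> True"
| "admissible (SIP \<alpha>) \<longleftrightarrow> \<alpha> > 0"
| "admissible (SEP \<gamma>) \<longleftrightarrow> \<gamma> \<ge> 1"

fun occupations :: "particle_system \<Rightarrow> nat set" where
  "occupations IRW = UNIV"
| "occupations (SIP \<alpha>) = UNIV"
| "occupations (SEP \<gamma>) = {0..\<gamma>}"

fun rate :: "particle_system \<Rightarrow> nat \<Rightarrow> real" where
  "rate IRW n = 1"
| "rate (SIP \<alpha>) n = \<alpha> + real n"
| "rate (SEP \<gamma>) n = real \<gamma> - real n"

definition configurations :: "particle_system \<Rightarrow> ('v \<Rightarrow> nat) set" where
  "configurations sys = {\<eta>. \<forall>x. \<eta> x \<in> occupations sys}"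

(* The terminating hypergeometric sum 2F1(-n, -k; c; w). *)
definition hyp2F1_neg :: "nat \<Rightarrow> nat \<Rightarrow> real \<Rightarrow> real \<Rightarrow> real" where
  "hyp2F1_neg n k c w =
     (\<Sum>r = 0..min k n. pochhammer (- real n) r * pochhammer (- real k) r / pochhammer c r
        * (w ^ r / fact r))"

fun duality_polynomial :: "particle_system \<Rightarrow> real \<Rightarrow> real \<Rightarrow> nat \<Rightarrow> nat \<Rightarrow> real" where
  "duality_polynomial IRW a b k n =
     (if a = 0 then (if k \<le> n then fact n / fact (n - k) * b ^ k else 0)
      else a ^ k * (\<Sum>r = 0..min k n. real (n choose r) * real (k choose r) * fact r * (b / a) ^ r))"
| "duality_polynomial (SIP \<alpha>) a b k n =
     (if a = 0
      then (if k \<le> n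
            then fact n / fact (n - k) * (Gamma \<alpha> / Gamma (\<alpha> + real k)) * (b * \<alpha>) ^ k else 0)
      else a ^ k * hyp2F1_neg n k \<alpha> (b * \<alpha> / a))"
| "duality_polynomial (SEP \<gamma>) a b k n =
     (if a = 0
      then (if k \<le> n
            then fact (\<gamma> - k) / fact \<gamma> * (fact n / fact (n - k)) * (b * real \<gamma>) ^ k else 0)
      else a ^ k * hyp2F1_neg n k (- real \<gamma>) (- (b * real \<gamma> / a)))"

end

theory Submission
  imports Defs "HOL-Real_Asymp.Real_Asymp"
begin

text \<open>On the finite classes of configurations with a fixed number of particles, duality of the semigroups
  is equivalent to duality of the generators. Testing the latter on \<open>\<xi> = k \<delta>\<^sub>x\<close> gives
  \<open>d(k, 0) = d(1, 0)\<^sup>k\<close> and, by comparing \<open>\<eta>\<^sub>y = 1\<close> with \<open>\<eta>\<^sub>y = 0\<close>, a first-order-in-\<open>k\<close>,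
  second-order-in-\<open>n\<close> recursion that determines \<open>d\<close> from \<open>a = d(1, 0)\<close> and
  \<open>b = d(1, 1) - d(1, 0)\<close>. Conversely, with \<open>v(n) = c + s n\<close>, in all three systems the solution is
  \<open>d(k, n) = \<Sum>\<^sub>r a\<^bsup>k-r\<^esup> (b c)\<^sup>r (n choose r) (k choose r) r! / (v(0) \<cdots> v(r - 1))\<close>. It intertwines the
  lowering, raising and number operators acting on \<open>k\<close> with those acting on \<open>n\<close> up to an automorphism
  that preserves the bond generator, which is a Casimir-type element.\<close>

section \<open>Duality of semigroups and of generators\<close>

text \<open>"No jump leaves \<open>C\<close>" is expressed through locality of \<open>L\<close>,
  without mentioning rates. Finiteness makes every function on \<open>C\<close> bounded, which
  matters because \<open>D\<close> may be unbounded.\<close>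

definition closed_class :: "'s set \<Rightarrow> (('s \<Rightarrow> real) \<Rightarrow> 's \<Rightarrow> real) \<Rightarrow> 's set \<Rightarrow> bool" where
  "closed_class S L C \<longleftrightarrow> finite C \<and> C \<subseteq> S \<and>
     (\<forall>\<zeta>\<in>C. \<forall>f g. (\<forall>z\<in>C. f z = g z) \<longrightarrow> L f \<zeta> = L g \<zeta>)"

section \<open>Invariance of finite closed classes and right derivatives on them\<close>

lemma markov_process_tendsto:
  assumes "markov_process S L P" "\<xi> \<in> S" "bounded (range f)"
  shows "((\<lambda>t. (measure_pmf.expectation (P t \<xi>) f - f \<xi>) / t) \<longlongrightarrow> L f \<xi>) (at_right 0)"
proof -
  have "\<forall>f. bounded (range f) \<longrightarrow> (\<forall>\<xi>\<in>S.
      ((\<lambda>t. (measure_pmf.expectation (P t \<xi>) f - f \<xi>) / t) \<longlongrightarrow> L f \<xi>) (at_right 0))"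
    using assms(1) unfolding markov_process_def by (elim conjE)
  with assms(2,3) show ?thesis
    by simp
qed

lemma markov_process_0:
  assumes "markov_process S L P" "\<xi> \<in> S"
  shows "P 0 \<xi> = return_pmf \<xi>"
  using assms unfolding markov_process_def by (elim conjE) (rule bspec)

lemma markov_process_add:
  assumes "markov_process S L P" "\<xi> \<in> S" "s \<ge> 0" "t \<ge> 0"
  shows "P (s + t) \<xi> = bind_pmf (P s \<xi>) (P t)"
proof -
  have "\<forall>s\<ge>0. \<forall>t\<ge>0. \<forall>\<xi>\<in>S. P (s + t) \<xi> = bind_pmf (P s \<xi>) (P t)"
    using assms(1) unfolding markov_process_def by (elim conjE)
  with assms(2-4) show ?thesis
    by (simp only: simp_thms)
qed

text \<open>Only those paths are counted that are in \<open>C\<close> at the intermediate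
  time.\<close>

lemma measure_bind_pmf_ge:
  assumes "c \<ge> 0" and "\<And>\<zeta>. \<zeta> \<in> C \<Longrightarrow> c \<le> measure_pmf.prob (q \<zeta>) C"
  shows "c * measure_pmf.prob p C \<le> measure_pmf.prob (bind_pmf p q) C"
proof -
  have "ennreal (c * measure_pmf.prob p C) = (\<integral>\<^sup>+\<zeta>. ennreal c * indicator C \<zeta> \<partial>p)"
    using assms(1) by (simp add: nn_integral_cmult ennreal_mult measure_pmf.emeasure_eq_measure)
  also have "\<dots> \<le> (\<integral>\<^sup>+\<zeta>. emeasure (q \<zeta>) C \<partial>p)"
    using assms(2) by (intro nn_integral_mono)
      (auto split: split_indicator simp: measure_pmf.emeasure_eq_measure)
  also have "\<dots> = ennreal (measure_pmf.prob (bind_pmf p q) C)"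
    by (metis emeasure_bind_pmf measure_pmf.emeasure_eq_measure)
  finally show ?thesis
    by simp
qed

lemma eventually_uniform_step:
  assumes "eventually Q (at_right (0::real))" "t > 0"
  shows "\<forall>\<^sub>F n in sequentially. n > 0 \<and> Q (t / real n)"
proof -
  have "filterlim (\<lambda>n. t / real n) (at_right 0) sequentially"
    using assms(2) by real_asymp
  then have "\<forall>\<^sub>F n in sequentially. Q (t / real n)"
    using assms(1) by (rule eventually_compose_filterlim[rotated])
  then show ?thesis
    using eventually_gt_at_top[of 0] by eventually_elim auto
qed

text \<open>The probability of staying in a finite closed class is at least \<open>1 - o(h)\<close> over a time step
  \<open>h\<close>, uniformly on the class, hence at least \<open>(1 - o(t / n)) ^ n\<close> over time \<open>t\<close>.\<close>

lemma closed_class_invariant: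
  assumes P: "markov_process S L P" and C: "closed_class S L C" and "\<xi> \<in> C" "t \<ge> 0"
  shows "set_pmf (P t \<xi>) \<subseteq> C"
proof (cases "t = 0")
  case True
  moreover have "\<xi> \<in> S"
    using C \<open>\<xi> \<in> C\<close> by (auto simp: closed_class_def)
  ultimately show ?thesis
    using \<open>\<xi> \<in> C\<close> by (simp add: markov_process_0[OF P])
next
  case False
  with \<open>t \<ge> 0\<close> have "t > 0"
    by simp
  have CS: "C \<subseteq> S" and finC: "finite C"
    using C by (auto simp: closed_class_def)
  \<comment> \<open>\<open>L\<close> annihilates constants because their expectation does not
    change, and on \<open>C\<close> the indicator of \<open>C\<close> agrees with the constant 1.
    Hence the staying probability has right derivative 0.\<close>
  have lim: "((\<lambda>h. (measure_pmf.prob (P h \<zeta>) C - 1) / h) \<longlongrightarrow> 0) (at_right 0)" if "\<zeta> \<in> C" for \<zeta>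
  proof -
    have "((\<lambda>t. (measure_pmf.expectation (P t \<zeta>) (\<lambda>_. 1) - 1) / t) \<longlongrightarrow> L (\<lambda>_. 1) \<zeta>) (at_right 0)"
      using that CS by (intro markov_process_tendsto[OF P]) auto
    then have "((\<lambda>t::real. 0) \<longlongrightarrow> L (\<lambda>_. 1) \<zeta>) (at_right 0)"
      by simp
    then have "L (\<lambda>_. 1) \<zeta> = 0"
      using tendsto_unique[OF trivial_limit_at_right_real _ tendsto_const] by blast
    moreover have "L (indicator C) \<zeta> = L (\<lambda>_. 1) \<zeta>"
      using C that unfolding closed_class_def by (metis indicator_simps(1))
    moreover have "bounded (range (indicator C :: _ \<Rightarrow> real))"
      by (rule boundedI[of _ 1]) (auto simp: indicator_def)
    moreover have "\<zeta> \<in> S"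
      using that CS by blast
    ultimately show ?thesis
      using markov_process_tendsto[OF P, of \<zeta> "indicator C"] that by simp
  qed
  have key: "measure_pmf.prob (P t \<xi>) C \<ge> 1 - \<epsilon> * t" if "\<epsilon> > 0" for \<epsilon>
  proof -
    have "\<forall>\<^sub>F h in at_right 0. \<forall>\<zeta>\<in>C. measure_pmf.prob (P h \<zeta>) C \<ge> 1 - \<epsilon> * h"
    proof (rule eventually_ball_finite[OF finC], rule ballI)
      fix \<zeta> assume "\<zeta> \<in> C"
      have "\<forall>\<^sub>F h in at_right 0. - \<epsilon> < (measure_pmf.prob (P h \<zeta>) C - 1) / h"
        by (rule order_tendstoD(1)[OF lim[OF \<open>\<zeta> \<in> C\<close>]]) (use that in simp)
      then show "\<forall>\<^sub>F h in at_right 0. measure_pmf.prob (P h \<zeta>) C \<ge> 1 - \<epsilon> * h"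
        using eventually_at_right_less[of 0]
        by eventually_elim (simp add: pos_less_divide_eq algebra_simps)
    qed
    \<comment> \<open>Keeps \<open>1 - \<epsilon> * h\<close> nonnegative, so that the one-step
      bounds can be multiplied.\<close>
    moreover have "\<forall>\<^sub>F h in at_right 0. \<epsilon> * h \<le> 1"
      using eventually_at_right_real[of 0 "1 / \<epsilon>"] that
      by (auto elim!: eventually_mono simp: field_simps)
    ultimately have "\<forall>\<^sub>F h in at_right 0.
        (\<forall>\<zeta>\<in>C. measure_pmf.prob (P h \<zeta>) C \<ge> 1 - \<epsilon> * h) \<and> \<epsilon> * h \<le> 1"
      by (rule eventually_conj)
    from eventually_happens[OF eventually_uniform_step[OF this \<open>t > 0\<close>]]
    obtain n where "n > 0" and n: "\<And>\<zeta>. \<zeta> \<in> C \<Longrightarrow> measure_pmf.prob (P (t / real n) \<zeta>) C \<ge> 1 - \<epsilon> * (t / real n)"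
      "\<epsilon> * (t / real n) \<le> 1"
      by auto
    define h where "h = t / real n"
    have h: "h \<ge> 0" "t = real n * h"
      using \<open>n > 0\<close> \<open>t > 0\<close> by (auto simp: h_def)
    have "measure_pmf.prob (P (real m * h) \<zeta>) C \<ge> (1 - \<epsilon> * h) ^ m" if "\<zeta> \<in> C" for m \<zeta>
      using that
    proof (induction m)
      case 0
      then show ?case
        using markov_process_0[OF P, of \<zeta>] CS by (auto simp: indicator_def)
    next
      case (Suc m)
      have "P (real (Suc m) * h) \<zeta> = bind_pmf (P (real m * h) \<zeta>) (P h)"
        using markov_process_add[OF P, of \<zeta> "real m * h" h] h Suc.prems CS
        by (auto simp: algebra_simps)
      moreover have "(1 - \<epsilon> * h) * measure_pmf.prob (P (real m * h) \<zeta>) C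
          \<le> measure_pmf.prob (bind_pmf (P (real m * h) \<zeta>) (P h)) C"
        using n by (intro measure_bind_pmf_ge) (auto simp: h_def)
      moreover have "(1 - \<epsilon> * h) * (1 - \<epsilon> * h) ^ m \<le> (1 - \<epsilon> * h) * measure_pmf.prob (P (real m * h) \<zeta>) C"
        using n Suc by (intro mult_left_mono) (auto simp: h_def)
      ultimately show ?case
        by simp
    qed
    from this[OF \<open>\<xi> \<in> C\<close>, of n] have "measure_pmf.prob (P t \<xi>) C \<ge> (1 - \<epsilon> * h) ^ n"
      using h by simp
    \<comment> \<open>Bernoulli turns the product of \<open>n\<close> one-step bounds into
      \<open>1 - \<epsilon> * t\<close>, which no longer depends on \<open>n\<close>.\<close>
    moreover have "1 + real n * (- \<epsilon> * h) \<le> (1 + (- \<epsilon> * h)) ^ n"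
      using n by (intro Bernoulli_inequality) (auto simp: h_def)
    ultimately show ?thesis
      using h by (simp add: algebra_simps)
  qed
  have "measure_pmf.prob (P t \<xi>) C \<ge> 1"
  proof (rule field_le_epsilon)
    fix e :: real assume "e > 0"
    then show "1 \<le> measure_pmf.prob (P t \<xi>) C + e"
      using key[of "e / t"] \<open>t > 0\<close> by simp
  qed
  then have "measure_pmf.prob (P t \<xi>) C = 1"
    using measure_pmf.prob_le_1 by (metis order_antisym)
  then show ?thesis
    by (subst (asm) measure_pmf.prob_eq_1) (auto simp: AE_measure_pmf_iff)
qed

text \<open>The process stays in the finite set \<open>C\<close>, so \<open>f\<close> may be
  truncated to a bounded function outside \<open>C\<close>. This makes the derivative at time 0
  available for unbounded \<open>f\<close>.\<close>

lemma closed_class_tendsto: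
  assumes P: "markov_process S L P" and C: "closed_class S L C" and "\<xi> \<in> C"
  shows "((\<lambda>t. (measure_pmf.expectation (P t \<xi>) f - f \<xi>) / t) \<longlongrightarrow> L f \<xi>) (at_right 0)"
proof -
  define g where "g = (\<lambda>z. if z \<in> C then f z else 0)"
  have "finite C" "\<xi> \<in> S"
    using C \<open>\<xi> \<in> C\<close> by (auto simp: closed_class_def)
  have "range g \<subseteq> insert 0 (f ` C)"
    by (auto simp: g_def)
  then have "bounded (range g)"
    using \<open>finite C\<close> by (meson finite_imp_bounded finite_imageI finite_insert finite_subset)
  from markov_process_tendsto[OF P \<open>\<xi> \<in> S\<close> this]
  have lim: "((\<lambda>t. (measure_pmf.expectation (P t \<xi>) g - g \<xi>) / t) \<longlongrightarrow> L g \<xi>) (at_right 0)" .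
  have "L g \<xi> = L f \<xi>"
    using C \<open>\<xi> \<in> C\<close> unfolding closed_class_def by (metis g_def)
  moreover have "\<forall>\<^sub>F t in at_right 0. (measure_pmf.expectation (P t \<xi>) g - g \<xi>) / t =
      (measure_pmf.expectation (P t \<xi>) f - f \<xi>) / t"
    using eventually_at_right_less[of 0]
  proof eventually_elim
    case (elim t)
    then have "set_pmf (P t \<xi>) \<subseteq> C"
      using closed_class_invariant[OF P C \<open>\<xi> \<in> C\<close>] by simp
    then have "measure_pmf.expectation (P t \<xi>) g = measure_pmf.expectation (P t \<xi>) f"
      by (intro integral_cong_AE) (auto simp: AE_measure_pmf_iff g_def)
    then show ?case
      using \<open>\<xi> \<in> C\<close> by (simp add: g_def)
  qed
  ultimately show ?thesis
    using Lim_transform_eventually[OF lim] by simp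
qed

section \<open>Finitely supported laws and comparison of the two semigroups\<close>

lemma expectation_bind_pmf_finite:
  fixes p :: "'a pmf" and f :: "'b \<Rightarrow> real"
  assumes "finite A" "set_pmf p \<subseteq> A" "\<And>x. x \<in> A \<Longrightarrow> finite (set_pmf (q x))"
  shows "measure_pmf.expectation (bind_pmf p q) f =
    measure_pmf.expectation p (\<lambda>x. measure_pmf.expectation (q x) f)"
proof -
  have "measure_pmf.expectation p (\<lambda>x. measure_pmf.expectation (q x) f) =
      (\<Sum>a\<in>A. measure_pmf.expectation (q a) f * pmf p a)"
    using assms by (intro integral_measure_pmf_real) auto
  then show ?thesis
    using pmf_expectation_bind[OF assms(1,3,2), where h = f] by (simp add: mult.commute)
qed

lemma expectation_swap_finite:
  fixes f :: "'a \<Rightarrow> 'b \<Rightarrow> real"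
  assumes "finite (set_pmf p)" "finite (set_pmf q)"
  shows "measure_pmf.expectation p (\<lambda>x. measure_pmf.expectation q (f x)) =
    measure_pmf.expectation q (\<lambda>y. measure_pmf.expectation p (\<lambda>x. f x y))"
proof -
  have p: "measure_pmf.expectation p f = (\<Sum>x\<in>set_pmf p. f x * pmf p x)" for f
    using assms(1) by (intro integral_measure_pmf_real)
  have q: "measure_pmf.expectation q f = (\<Sum>x\<in>set_pmf q. f x * pmf q x)" for f
    using assms(2) by (intro integral_measure_pmf_real)
  show ?thesis
    unfolding p q sum_distrib_right
    by (subst sum.swap) (intro sum.cong refl, simp add: mult_ac)
qed

lemma expectation_diff_le:
  fixes f g :: "'a \<Rightarrow> real"
  assumes "finite (set_pmf p)" "\<And>x. x \<in> set_pmf p \<Longrightarrow> \<bar>f x - g x\<bar> \<le> M"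
  shows "\<bar>measure_pmf.expectation p f - measure_pmf.expectation p g\<bar> \<le> M"
proof -
  have "measure_pmf.expectation p f - measure_pmf.expectation p g = measure_pmf.expectation p (\<lambda>x. f x - g x)"
    using assms(1) by (simp add: integrable_measure_pmf_finite)
  also have "\<bar>\<dots>\<bar> \<le> measure_pmf.expectation p (\<lambda>x. \<bar>f x - g x\<bar>)"
    by (rule integral_abs_bound)
  also have "\<dots> \<le> measure_pmf.expectation p (\<lambda>_. M)"
    using assms by (intro integral_mono_AE) (auto simp: AE_measure_pmf_iff integrable_measure_pmf_finite)
  finally show ?thesis
    by simp
qed

text \<open>Trading one time step \<open>h\<close> of one process for a time step of the other costs at most \<open>M = o(h)\<close>.\<close>

lemma semigroup_duality_error:
  assumes P: "markov_process S L P" and A: "closed_class S L A" and B: "closed_class S L B"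
    and "h \<ge> 0"
    and M: "\<And>\<xi> \<eta>. \<xi> \<in> A \<Longrightarrow> \<eta> \<in> B \<Longrightarrow>
      \<bar>measure_pmf.expectation (P h \<xi>) (\<lambda>\<zeta>. D \<zeta> \<eta>) - measure_pmf.expectation (P h \<eta>) (D \<xi>)\<bar> \<le> M"
    and "\<xi> \<in> A" "\<eta> \<in> B"
  shows "\<bar>measure_pmf.expectation (P (real n * h) \<xi>) (\<lambda>\<zeta>. D \<zeta> \<eta>)
    - measure_pmf.expectation (P (real n * h) \<eta>) (D \<xi>)\<bar> \<le> real n * M"
  using \<open>\<xi> \<in> A\<close> \<open>\<eta> \<in> B\<close>
proof (induction n arbitrary: \<xi> \<eta>)
  case 0
  then show ?case
    using A B by (auto simp: markov_process_0[OF P] closed_class_def subset_iff)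
next
  case (Suc n)
  define s where "s = real n * h"
  have s: "s \<ge> 0" "real (Suc n) * h = h + s" "h + s = s + h"
    using \<open>h \<ge> 0\<close> by (auto simp: s_def algebra_simps)
  have fin: "finite A" "finite B" "\<xi> \<in> S" "\<eta> \<in> S"
    using A B Suc.prems by (auto simp: closed_class_def)
  have inA: "set_pmf (P u \<zeta>) \<subseteq> A" "finite (set_pmf (P u \<zeta>))" if "\<zeta> \<in> A" "u \<ge> 0" for u \<zeta>
    using closed_class_invariant[OF P A that] fin by (auto intro: finite_subset)
  have inB: "set_pmf (P u \<zeta>) \<subseteq> B" "finite (set_pmf (P u \<zeta>))" if "\<zeta> \<in> B" "u \<ge> 0" for u \<zeta>
    using closed_class_invariant[OF P B that] fin by (auto intro: finite_subset)
  \<comment> \<open>The process from \<open>\<xi>\<close> takes the extra step \<open>h\<close>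
    first, the one from \<open>\<eta>\<close> takes it last. With the expectations swapped in
    between, the induction hypothesis covers the time \<open>s\<close> and \<open>M\<close> covers
    the step \<open>h\<close>.\<close>
  have 1: "measure_pmf.expectation (P (h + s) \<xi>) (\<lambda>\<zeta>. D \<zeta> \<eta>) =
      measure_pmf.expectation (P h \<xi>) (\<lambda>x. measure_pmf.expectation (P s x) (\<lambda>\<zeta>. D \<zeta> \<eta>))"
    using fin s(1) \<open>h \<ge> 0\<close> Suc.prems inA
    by (simp add: markov_process_add[OF P] expectation_bind_pmf_finite[of A])
  have 2: "measure_pmf.expectation (P (h + s) \<eta>) (D \<xi>) =
      measure_pmf.expectation (P s \<eta>) (\<lambda>y. measure_pmf.expectation (P h y) (D \<xi>))"
    unfolding s(3) using fin s(1) \<open>h \<ge> 0\<close> Suc.prems inB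
    by (simp add: markov_process_add[OF P] expectation_bind_pmf_finite[of B])
  have 3: "measure_pmf.expectation (P h \<xi>) (\<lambda>x. measure_pmf.expectation (P s \<eta>) (D x)) =
      measure_pmf.expectation (P s \<eta>) (\<lambda>y. measure_pmf.expectation (P h \<xi>) (\<lambda>x. D x y))"
    using inA inB Suc.prems s(1) \<open>h \<ge> 0\<close> by (intro expectation_swap_finite)
  have 4: "\<bar>measure_pmf.expectation (P h \<xi>) (\<lambda>x. measure_pmf.expectation (P s x) (\<lambda>\<zeta>. D \<zeta> \<eta>))
      - measure_pmf.expectation (P h \<xi>) (\<lambda>x. measure_pmf.expectation (P s \<eta>) (D x))\<bar> \<le> real n * M"
    using Suc.IH Suc.prems inA[of \<xi> h] \<open>h \<ge> 0\<close> by (intro expectation_diff_le) (auto simp: s_def)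
  have 5: "\<bar>measure_pmf.expectation (P s \<eta>) (\<lambda>y. measure_pmf.expectation (P h \<xi>) (\<lambda>x. D x y))
      - measure_pmf.expectation (P s \<eta>) (\<lambda>y. measure_pmf.expectation (P h y) (D \<xi>))\<bar> \<le> M"
    using M Suc.prems inB[of \<eta> s] s(1) by (intro expectation_diff_le) auto
  show ?case
    using 1 2 3 4 5 unfolding s(2) by (simp add: algebra_simps)
qed

text \<open>Forward, the semigroup identity is differentiated at time 0. Backward, time
  \<open>t\<close> is cut into \<open>n\<close> steps whose errors are at most
  \<open>\<epsilon> * (t / n)\<close>, which add up to \<open>\<epsilon> * t\<close> with
  \<open>\<epsilon>\<close> arbitrary.\<close>

theorem self_duality_iff_generator_duality:
  assumes P: "markov_process S L P"
    and classes: "\<And>\<xi>. \<xi> \<in> S \<Longrightarrow> \<exists>C. \<xi> \<in> C \<and> closed_class S L C"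
  shows "self_duality_function S P D \<longleftrightarrow> (\<forall>\<xi>\<in>S. \<forall>\<eta>\<in>S. L (\<lambda>\<zeta>. D \<zeta> \<eta>) \<xi> = L (D \<xi>) \<eta>)"
proof
  assume dual: "self_duality_function S P D"
  show "\<forall>\<xi>\<in>S. \<forall>\<eta>\<in>S. L (\<lambda>\<zeta>. D \<zeta> \<eta>) \<xi> = L (D \<xi>) \<eta>"
  proof (intro ballI)
    fix \<xi> \<eta> assume "\<xi> \<in> S" "\<eta> \<in> S"
    from classes[OF \<open>\<xi> \<in> S\<close>] closed_class_tendsto[OF P]
    have lim: "((\<lambda>t. (measure_pmf.expectation (P t \<xi>) (\<lambda>\<zeta>. D \<zeta> \<eta>) - D \<xi> \<eta>) / t)
        \<longlongrightarrow> L (\<lambda>\<zeta>. D \<zeta> \<eta>) \<xi>) (at_right 0)"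
      by blast
    moreover have "\<forall>\<^sub>F t in at_right 0. (measure_pmf.expectation (P t \<xi>) (\<lambda>\<zeta>. D \<zeta> \<eta>) - D \<xi> \<eta>) / t =
        (measure_pmf.expectation (P t \<eta>) (D \<xi>) - D \<xi> \<eta>) / t"
      using eventually_at_right_less[of 0]
      by eventually_elim (use dual \<open>\<xi> \<in> S\<close> \<open>\<eta> \<in> S\<close> in \<open>auto simp: self_duality_function_def\<close>)
    ultimately have "((\<lambda>t. (measure_pmf.expectation (P t \<eta>) (D \<xi>) - D \<xi> \<eta>) / t)
        \<longlongrightarrow> L (\<lambda>\<zeta>. D \<zeta> \<eta>) \<xi>) (at_right 0)"
      by (rule Lim_transform_eventually)
    moreover have "((\<lambda>t. (measure_pmf.expectation (P t \<eta>) (D \<xi>) - D \<xi> \<eta>) / t)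
        \<longlongrightarrow> L (D \<xi>) \<eta>) (at_right 0)"
      using classes[OF \<open>\<eta> \<in> S\<close>] closed_class_tendsto[OF P] by blast
    ultimately show "L (\<lambda>\<zeta>. D \<zeta> \<eta>) \<xi> = L (D \<xi>) \<eta>"
      by (rule tendsto_unique[OF trivial_limit_at_right_real])
  qed
next
  assume gen: "\<forall>\<xi>\<in>S. \<forall>\<eta>\<in>S. L (\<lambda>\<zeta>. D \<zeta> \<eta>) \<xi> = L (D \<xi>) \<eta>"
  show "self_duality_function S P D"
    unfolding self_duality_function_def
  proof (intro allI impI ballI)
    fix t :: real and \<xi> \<eta> assume "t > 0" "\<xi> \<in> S" "\<eta> \<in> S"
    obtain A where A: "\<xi> \<in> A" "closed_class S L A"
      using classes[OF \<open>\<xi> \<in> S\<close>] by blast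
    obtain B where B: "\<eta> \<in> B" "closed_class S L B"
      using classes[OF \<open>\<eta> \<in> S\<close>] by blast
    have fin: "finite A" "finite B" and sub: "A \<subseteq> S" "B \<subseteq> S"
      using A B by (auto simp: closed_class_def)
    have err: "\<bar>measure_pmf.expectation (P t \<xi>) (\<lambda>\<zeta>. D \<zeta> \<eta>) - measure_pmf.expectation (P t \<eta>) (D \<xi>)\<bar> \<le> \<epsilon> * t"
      if "\<epsilon> > 0" for \<epsilon>
    proof -
      have "\<forall>\<^sub>F h in at_right 0. \<forall>x\<in>A. \<forall>y\<in>B.
        \<bar>measure_pmf.expectation (P h x) (\<lambda>\<zeta>. D \<zeta> y) - measure_pmf.expectation (P h y) (D x)\<bar> \<le> \<epsilon> * h"
      proof (intro eventually_ball_finite fin ballI)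
        fix x y assume xy: "x \<in> A" "y \<in> B"
        \<comment> \<open>Both expectations start from \<open>D x y\<close> and have the same
          derivative at 0; finiteness of \<open>A\<close> and \<open>B\<close> makes the resulting
          bound uniform.\<close>
        have "((\<lambda>h. (measure_pmf.expectation (P h x) (\<lambda>\<zeta>. D \<zeta> y) - D x y) / h
            - (measure_pmf.expectation (P h y) (D x) - D x y) / h) \<longlongrightarrow> L (\<lambda>\<zeta>. D \<zeta> y) x - L (D x) y) (at_right 0)"
          using xy A B by (intro tendsto_diff closed_class_tendsto[OF P]) auto
        moreover have "L (\<lambda>\<zeta>. D \<zeta> y) x - L (D x) y = 0"
          using gen xy sub by auto
        ultimately have "((\<lambda>h. (measure_pmf.expectation (P h x) (\<lambda>\<zeta>. D \<zeta> y)
            - measure_pmf.expectation (P h y) (D x)) / h) \<longlongrightarrow> 0) (at_right 0)"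
          by (simp add: diff_divide_distrib)
        from tendstoD[OF this \<open>\<epsilon> > 0\<close>] eventually_at_right_less[of 0]
        show "\<forall>\<^sub>F h in at_right 0. \<bar>measure_pmf.expectation (P h x) (\<lambda>\<zeta>. D \<zeta> y)
            - measure_pmf.expectation (P h y) (D x)\<bar> \<le> \<epsilon> * h"
          by eventually_elim (simp add: dist_real_def field_simps)
      qed
      from eventually_happens[OF eventually_uniform_step[OF this \<open>t > 0\<close>]]
      obtain n where "n > 0" and n: "\<And>x y. x \<in> A \<Longrightarrow> y \<in> B \<Longrightarrow>
        \<bar>measure_pmf.expectation (P (t / real n) x) (\<lambda>\<zeta>. D \<zeta> y)
          - measure_pmf.expectation (P (t / real n) y) (D x)\<bar> \<le> \<epsilon> * (t / real n)"
        by auto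
      have "t / real n \<ge> 0"
        using \<open>t > 0\<close> by simp
      from semigroup_duality_error[OF P A(2) B(2) this n A(1) B(1), of n]
      show ?thesis
        using \<open>n > 0\<close> by simp
    qed
    have "\<bar>measure_pmf.expectation (P t \<xi>) (\<lambda>\<zeta>. D \<zeta> \<eta>) - measure_pmf.expectation (P t \<eta>) (D \<xi>)\<bar> \<le> 0"
    proof (rule field_le_epsilon)
      fix e :: real assume "e > 0"
      then show "\<bar>measure_pmf.expectation (P t \<xi>) (\<lambda>\<zeta>. D \<zeta> \<eta>) - measure_pmf.expectation (P t \<eta>) (D \<xi>)\<bar> \<le> 0 + e"
        using err[of "e / t"] \<open>t > 0\<close> by simp
    qed
    then show "measure_pmf.expectation (P t \<xi>) (\<lambda>\<zeta>. D \<zeta> \<eta>) = measure_pmf.expectation (P t \<eta>) (D \<xi>)"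
      by simp
  qed
qed

section \<open>The duality polynomials\<close>

text \<open>With \<open>v(n) = c + s n\<close> this is \<open>v(0) ... v(r - 1)\<close>: the
  constant 1 for IRW, a rising factorial of \<open>\<alpha>\<close> for SIP, a falling factorial of
  \<open>\<gamma>\<close> for SEP.\<close>

definition rate_factorial :: "real \<Rightarrow> real \<Rightarrow> nat \<Rightarrow> real" where
  "rate_factorial c s r = (\<Prod>i<r. c + s * real i)"

text \<open>Here \<open>\<beta>\<close> stands for \<open>b c\<close>. Writing
  \<open>a ^ (k - r)\<close> instead of dividing by \<open>a ^ r\<close> includes the case
  \<open>a = 0\<close>; truncated subtraction is harmless, as \<open>k choose r\<close> vanishes for
  \<open>r > k\<close>.\<close>

definition dual_term :: "real \<Rightarrow> real \<Rightarrow> real \<Rightarrow> real \<Rightarrow> nat \<Rightarrow> nat \<Rightarrow> nat \<Rightarrow> real" where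
  "dual_term c s a \<beta> k n r =
     a ^ (k - r) * \<beta> ^ r * real (n choose r) * real (k choose r) * fact r / rate_factorial c s r"

definition dual_series :: "real \<Rightarrow> real \<Rightarrow> real \<Rightarrow> real \<Rightarrow> nat \<Rightarrow> nat \<Rightarrow> real" where
  "dual_series c s a \<beta> k n = (\<Sum>r\<le>min k n. dual_term c s a \<beta> k n r)"

text \<open>The binomials vanish beyond \<open>min k n\<close>, so series with neighbouring
  arguments can be summed over one common range.\<close>

lemma dual_series_eq_sum:
  assumes "min k n \<le> R"
  shows "dual_series c s a \<beta> k n = (\<Sum>r\<le>R. dual_term c s a \<beta> k n r)"
  unfolding dual_series_def using assms
  by (intro sum.mono_neutral_left) (auto simp: dual_term_def)

lemma dual_series_0_right [simp]: "dual_series c s a \<beta> k 0 = a ^ k"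
  by (simp add: dual_series_def dual_term_def rate_factorial_def)

lemma dual_series_0_left [simp]: "dual_series c s a \<beta> 0 n = 1"
  by (simp add: dual_series_def dual_term_def rate_factorial_def)

section \<open>Difference operators on binomials and on the series\<close>

lemma real_binomial_absorb_comp:
  "real n * real ((n - 1) choose r) = (real n - real r) * real (n choose r)"
proof (cases "r \<le> n")
  case True
  then show ?thesis
    using arg_cong[OF binomial_absorb_comp[of n r], of real] by (simp add: of_nat_diff)
next
  case False
  then have "n choose r = 0" "(n - 1) choose r = 0"
    by (auto intro!: binomial_eq_0)
  then show ?thesis by (simp only: of_nat_0 mult_zero_right)
qed

lemma real_binomial_absorption:
  "real n * real ((n - 1) choose r) = real (Suc r) * real (n choose Suc r)"
  by (metis binomial_absorption of_nat_mult)

text \<open>The left side is \<open>s n\<close> times the central second difference plus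
  \<open>c\<close> times the forward difference. It lowers \<open>n choose r\<close> to
  \<open>n choose (r - 1)\<close>, with the rate \<open>v(r - 1)\<close> as multiplier.\<close>

lemma second_difference_binomial:
  "s * real n * real ((n - 1) choose r) - 2 * s * real n * real (n choose r) - c * real (n choose r)
     + (c + s * real n) * real (Suc n choose r) =
   (case r of 0 \<Rightarrow> 0 | Suc q \<Rightarrow> (c + s * real q) * real (n choose q))"
proof (cases r)
  case 0
  then show ?thesis by (simp add: algebra_simps)
next
  case (Suc q)
  have 1: "real n * real ((n - 1) choose Suc q) = (real n - real (Suc q)) * real (n choose Suc q)"
    by (rule real_binomial_absorb_comp)
  have "real (Suc q) * real (n choose Suc q) = (real n - real q) * real (n choose q)"
    by (metis real_binomial_absorb_comp real_binomial_absorption)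
  then have 2: "real n * real ((n - 1) choose Suc q) - real n * real (n choose Suc q) = (real q - real n) * real (n choose q)"
    unfolding 1 by (simp add: algebra_simps)
  have "s * real n * real ((n - 1) choose Suc q) - 2 * s * real n * real (n choose Suc q) - c * real (n choose Suc q)
     + (c + s * real n) * real (Suc n choose Suc q) =
    s * (real n * real ((n - 1) choose Suc q) - real n * real (n choose Suc q)) + (c + s * real n) * real (n choose q)"
    by (simp add: algebra_simps)
  also have "\<dots> = (c + s * real q) * real (n choose q)"
    unfolding 2 by (simp add: algebra_simps)
  finally show ?thesis
    using Suc by simp
qed

lemma rate_factorial_shift:
  assumes "rate_factorial c s (Suc q) \<noteq> 0"
  shows "(c + s * real q) / rate_factorial c s (Suc q) = 1 / rate_factorial c s q"
  using assms by (simp add: rate_factorial_def)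

text \<open>The operator in \<open>n\<close> acts on each \<open>n choose r\<close>. Its multiplier
  \<open>v(r - 1)\<close> cancels the last factor of \<open>rate_factorial\<close>, and absorption
  in \<open>k\<close> turns the shifted terms into those for \<open>k - 1\<close>.\<close>

lemma dual_series_lower_left:
  assumes nz: "\<And>r. r \<le> k \<Longrightarrow> rate_factorial c s r \<noteq> 0"
  shows "\<beta> * real k * dual_series c s a \<beta> (k - 1) n =
    s * real n * dual_series c s a \<beta> k (n - 1) - 2 * s * real n * dual_series c s a \<beta> k n
      - c * dual_series c s a \<beta> k n + (c + s * real n) * dual_series c s a \<beta> k (Suc n)"
proof -
  define T where "T r = a ^ (k - r) * \<beta> ^ r * real (k choose r) * fact r / rate_factorial c s r" for r
  have le: "min k m \<le> Suc k" for m
    by simp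
  have "s * real n * dual_series c s a \<beta> k (n - 1) - 2 * s * real n * dual_series c s a \<beta> k n
      - c * dual_series c s a \<beta> k n + (c + s * real n) * dual_series c s a \<beta> k (Suc n)
    = (\<Sum>r\<le>Suc k. T r * (s * real n * real ((n - 1) choose r) - 2 * s * real n * real (n choose r)
       - c * real (n choose r) + (c + s * real n) * real (Suc n choose r)))"
    unfolding dual_series_eq_sum[of k "n - 1" "Suc k", OF le] dual_series_eq_sum[of k n "Suc k", OF le]
      dual_series_eq_sum[of k "Suc n" "Suc k", OF le] sum_distrib_left
      sum.distrib[symmetric] sum_subtractf[symmetric]
    by (rule sum.cong) (simp_all add: T_def dual_term_def divide_inverse algebra_simps del: binomial_Suc_Suc)
  also have "\<dots> = (\<Sum>r\<le>k. T (Suc r) * ((c + s * real r) * real (n choose r)))"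
    unfolding second_difference_binomial by (subst sum.atMost_Suc_shift) simp
  also have "\<dots> = (\<Sum>r\<le>k. \<beta> * real k * dual_term c s a \<beta> (k - 1) n r)"
  proof (rule sum.cong[OF refl])
    fix r assume "r \<in> {..k}"
    show "T (Suc r) * ((c + s * real r) * real (n choose r)) = \<beta> * real k * dual_term c s a \<beta> (k - 1) n r"
    proof (cases "Suc r \<le> k")
      case True
      have "T (Suc r) * ((c + s * real r) * real (n choose r)) =
        a ^ (k - 1 - r) * \<beta> ^ Suc r * fact r * real (n choose r) *
          (real (Suc r) * real (k choose Suc r)) * ((c + s * real r) / rate_factorial c s (Suc r))"
        unfolding T_def divide_inverse by (simp add: mult_ac del: binomial_Suc_Suc)
      also have "\<dots> = \<beta> * real k * dual_term c s a \<beta> (k - 1) n r"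
        unfolding rate_factorial_shift[OF nz[OF True]] real_binomial_absorption[symmetric]
        by (simp add: dual_term_def)
      finally show ?thesis .
    next
      \<comment> \<open>Only \<open>r = k\<close> is left, where both sides vanish; if
        \<open>k = 0\<close>, where \<open>k - 1\<close> is truncated, the factor
        \<open>real k\<close> does this.\<close>
      case False
      then have "k choose Suc r = 0"
        by (intro binomial_eq_0) simp
      with real_binomial_absorption[of k r] have "real k * real ((k - 1) choose r) = 0"
        by simp
      then have "real k * dual_term c s a \<beta> (k - 1) n r = 0"
        unfolding dual_term_def by (simp only: mult_eq_0_iff divide_eq_0_iff) blast
      with \<open>k choose Suc r = 0\<close> show ?thesis
        by (simp only: T_def of_nat_0 mult_zero_right mult_zero_left div_0 mult.assoc)
    qed
  qed
  also have "\<dots> = \<beta> * real k * dual_series c s a \<beta> (k - 1) n"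
    by (simp add: dual_series_eq_sum[of _ _ k] sum_distrib_left)
  finally show ?thesis by simp
qed

text \<open>The mirror image in \<open>k\<close>. For \<open>a \<noteq> 0\<close> it is the same
  operator conjugated by \<open>a ^ k\<close>, which explains the coefficients \<open>a ^ 2\<close>,
  \<open>a\<close> and 1.\<close>

lemma dual_series_lower_right:
  assumes nz: "\<And>r. r \<le> n \<Longrightarrow> rate_factorial c s r \<noteq> 0"
  shows "\<beta> * real n * dual_series c s a \<beta> k (n - 1) =
    s * a ^ 2 * real k * dual_series c s a \<beta> (k - 1) n - 2 * s * a * real k * dual_series c s a \<beta> k n
      - c * a * dual_series c s a \<beta> k n + (c + s * real k) * dual_series c s a \<beta> (Suc k) n"
proof -
  \<comment> \<open>With the exponent \<open>Suc k - r\<close> the terms for \<open>k - 1\<close>,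
    \<open>k\<close> and \<open>k + 1\<close> share the factor \<open>T r\<close> without division
    by \<open>a\<close>.\<close>
  define T where "T r = a ^ (Suc k - r) * \<beta> ^ r * real (n choose r) * fact r / rate_factorial c s r" for r
  have le: "min m n \<le> Suc n" for m
    by simp
  have pow: "a * dual_term c s a \<beta> k n r = T r * real (k choose r)"
    "a ^ 2 * (real k * dual_term c s a \<beta> (k - 1) n r) = T r * (real k * real ((k - 1) choose r))"
    "dual_term c s a \<beta> (Suc k) n r = T r * real (Suc k choose r)" for r
  proof -
    show "a * dual_term c s a \<beta> k n r = T r * real (k choose r)"
      by (cases "r \<le> k") (simp_all add: T_def dual_term_def Suc_diff_le)
    show "a ^ 2 * (real k * dual_term c s a \<beta> (k - 1) n r) = T r * (real k * real ((k - 1) choose r))"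
    proof (cases k)
      case (Suc l)
      then show ?thesis
        by (cases "r \<le> l") (simp_all add: T_def dual_term_def Suc_diff_le power2_eq_square)
    qed simp
  qed (simp add: T_def dual_term_def)
  have "s * a ^ 2 * real k * dual_series c s a \<beta> (k - 1) n - 2 * s * a * real k * dual_series c s a \<beta> k n
      - c * a * dual_series c s a \<beta> k n + (c + s * real k) * dual_series c s a \<beta> (Suc k) n
    = (\<Sum>r\<le>Suc n. s * (a ^ 2 * (real k * dual_term c s a \<beta> (k - 1) n r))
       - 2 * s * real k * (a * dual_term c s a \<beta> k n r)
       - c * (a * dual_term c s a \<beta> k n r) + (c + s * real k) * dual_term c s a \<beta> (Suc k) n r)"
    unfolding dual_series_eq_sum[of "k - 1" n "Suc n", OF le] dual_series_eq_sum[of k n "Suc n", OF le]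
      dual_series_eq_sum[of "Suc k" n "Suc n", OF le] sum_distrib_left
      sum.distrib[symmetric] sum_subtractf[symmetric]
    by (simp add: mult_ac del: sum.atMost_Suc)
  also have "\<dots> = (\<Sum>r\<le>Suc n. T r * (s * real k * real ((k - 1) choose r) - 2 * s * real k * real (k choose r)
       - c * real (k choose r) + (c + s * real k) * real (Suc k choose r)))"
    unfolding pow by (simp add: algebra_simps del: sum.atMost_Suc binomial_Suc_Suc)
  also have "\<dots> = (\<Sum>r\<le>n. T (Suc r) * ((c + s * real r) * real (k choose r)))"
    unfolding second_difference_binomial by (subst sum.atMost_Suc_shift) simp
  also have "\<dots> = (\<Sum>r\<le>n. \<beta> * real n * dual_term c s a \<beta> k (n - 1) r)"
  proof (rule sum.cong[OF refl])
    fix r assume "r \<in> {..n}"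
    show "T (Suc r) * ((c + s * real r) * real (k choose r)) = \<beta> * real n * dual_term c s a \<beta> k (n - 1) r"
    proof (cases "Suc r \<le> n")
      case True
      have "T (Suc r) * ((c + s * real r) * real (k choose r)) =
        a ^ (k - r) * \<beta> ^ Suc r * fact r * real (k choose r) *
          (real (Suc r) * real (n choose Suc r)) * ((c + s * real r) / rate_factorial c s (Suc r))"
        unfolding T_def divide_inverse by (simp add: mult_ac del: binomial_Suc_Suc)
      also have "\<dots> = \<beta> * real n * dual_term c s a \<beta> k (n - 1) r"
        unfolding rate_factorial_shift[OF nz[OF True]] real_binomial_absorption[symmetric]
        by (simp add: dual_term_def)
      finally show ?thesis .
    next
      case False
      then have "n choose Suc r = 0"
        by (intro binomial_eq_0) simp
      with real_binomial_absorption[of n r] have "real n * real ((n - 1) choose r) = 0"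
        by simp
      then have "real n * dual_term c s a \<beta> k (n - 1) r = 0"
        unfolding dual_term_def by (simp only: mult_eq_0_iff divide_eq_0_iff) blast
      with \<open>n choose Suc r = 0\<close> show ?thesis
        by (simp only: T_def of_nat_0 mult_zero_right mult_zero_left div_0 mult.assoc)
    qed
  qed
  also have "\<dots> = \<beta> * real n * dual_series c s a \<beta> k (n - 1)"
    by (simp add: dual_series_eq_sum[of _ _ n] sum_distrib_left)
  finally show ?thesis by simp
qed

text \<open>Both sides weight the \<open>r\<close>-th term by \<open>r\<close>, because
  \<open>k (k choose r) - k ((k - 1) choose r) = r (k choose r)\<close> and likewise in
  \<open>n\<close>.\<close>

lemma dual_series_number:
  "real k * dual_series c s a \<beta> k n - a * real k * dual_series c s a \<beta> (k - 1) n =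
   real n * dual_series c s a \<beta> k n - real n * dual_series c s a \<beta> k (n - 1)"
proof -
  define T where "T r = a ^ (k - r) * \<beta> ^ r * fact r / rate_factorial c s r" for r
  have pow: "a * (real k * dual_term c s a \<beta> (k - 1) n r) = T r * real (n choose r) * (real k * real ((k - 1) choose r))" for r
  proof (cases k)
    case (Suc l)
    then show ?thesis
      by (cases "r \<le> l") (simp_all add: T_def dual_term_def Suc_diff_le)
  qed simp
  have "real k * dual_series c s a \<beta> k n - a * real k * dual_series c s a \<beta> (k - 1) n =
      (\<Sum>r\<le>k. real k * dual_term c s a \<beta> k n r - a * (real k * dual_term c s a \<beta> (k - 1) n r))"
    by (simp add: dual_series_eq_sum[of _ _ k] sum_distrib_left sum_subtractf mult.assoc)
  also have "\<dots> = (\<Sum>r\<le>k. real r * dual_term c s a \<beta> k n r)"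
    unfolding pow real_binomial_absorb_comp
    by (intro sum.cong) (simp_all add: dual_term_def T_def divide_inverse algebra_simps)
  also have "\<dots> = (\<Sum>r\<le>k. real n * dual_term c s a \<beta> k n r - T r * real (k choose r) * (real n * real ((n - 1) choose r)))"
    unfolding real_binomial_absorb_comp
    by (intro sum.cong) (simp_all add: dual_term_def T_def divide_inverse algebra_simps)
  also have "\<dots> = real n * dual_series c s a \<beta> k n - real n * dual_series c s a \<beta> k (n - 1)"
    by (simp add: dual_series_eq_sum[of _ _ k] sum_distrib_left sum_subtractf T_def dual_term_def mult_ac)
  finally show ?thesis .
qed

text \<open>\<open>A\<close>, \<open>B\<close> and \<open>N\<close> stand for \<open>k f(k - 1)\<close>, \<open>v(k) f(k + 1)\<close> and \<open>k f(k)\<close>; unprimed letters act on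
  the first and primed ones on the second argument of \<open>q\<^sub>i = d(k\<^sub>i, n\<^sub>i)\<close>, at the two sites \<open>i = 1, 2\<close>.
  The bond generator is \<open>A\<^sub>1 B\<^sub>2 + B\<^sub>1 A\<^sub>2 - c (N\<^sub>1 + N\<^sub>2) - 2 s N\<^sub>1 N\<^sub>2\<close>, and the three relations
  express that the actions on the two arguments are related by an automorphism that leaves this
  element invariant.\<close>

lemma bond_invariance:
  fixes A1 :: real
  assumes "\<beta> * A1 = s * A1' - 2 * s * N1' - c * q1 + B1'"
    and "\<beta> * A2 = s * A2' - 2 * s * N2' - c * q2 + B2'"
    and "\<beta> * A1' = s * a ^ 2 * A1 - 2 * s * a * N1 - c * a * q1 + B1"
    and "\<beta> * A2' = s * a ^ 2 * A2 - 2 * s * a * N2 - c * a * q2 + B2"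
    and "N1 - a * A1 = N1' - A1'"
    and "N2 - a * A2 = N2' - A2'"
  shows "A1 * B2 + B1 * A2 - c * (N1 * q2 + q1 * N2) - 2 * s * N1 * N2 =
    A1' * B2' + B1' * A2' - c * (N1' * q2 + q1 * N2') - 2 * s * N1' * N2'"
proof -
  \<comment> \<open>Eliminating the unprimed \<open>N\<close> and both kinds of \<open>B\<close>
    leaves a polynomial identity in the remaining quantities.\<close>
  have N: "N1 = a * A1 + N1' - A1'" "N2 = a * A2 + N2' - A2'"
    using assms(5,6) by auto
  have B: "B1 = \<beta> * A1' + s * a ^ 2 * A1 + 2 * s * a * (N1' - A1') + c * a * q1"
    "B2 = \<beta> * A2' + s * a ^ 2 * A2 + 2 * s * a * (N2' - A2') + c * a * q2"
    using assms(3,4) unfolding N by (simp_all add: algebra_simps power2_eq_square)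
  have B': "B1' = \<beta> * A1 - s * A1' + 2 * s * N1' + c * q1" "B2' = \<beta> * A2 - s * A2' + 2 * s * N2' + c * q2"
    using assms(1,2) by auto
  show ?thesis
    unfolding N B B' by (simp add: algebra_simps power2_eq_square)
qed

section \<open>The particle systems\<close>

fun rate_slope :: "particle_system \<Rightarrow> real" where
  "rate_slope IRW = 0"
| "rate_slope (SIP \<alpha>) = 1"
| "rate_slope (SEP \<gamma>) = -1"

lemma rate_affine: "rate sys n = rate sys 0 + rate_slope sys * real n"
  by (cases sys) auto

lemma rate_0_pos: "admissible sys \<Longrightarrow> rate sys 0 > 0"
  by (cases sys) auto

lemma occupations_downward: "n \<in> occupations sys \<Longrightarrow> m \<le> n \<Longrightarrow> m \<in> occupations sys"
  by (cases sys) auto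

lemma zero_in_occupations: "0 \<in> occupations sys"
  by (cases sys) auto

lemma one_in_occupations: "admissible sys \<Longrightarrow> Suc 0 \<in> occupations sys"
  by (cases sys) auto

text \<open>The rate into a site vanishes only in SEP at \<open>n = \<gamma>\<close>, a full site.
  So jumps out of the state space have rate 0.\<close>

lemma Suc_in_occupations_iff:
  "admissible sys \<Longrightarrow> n \<in> occupations sys \<Longrightarrow> Suc n \<in> occupations sys \<longleftrightarrow> rate sys n \<noteq> 0"
  by (cases sys) auto

text \<open>The rate can vanish only at a full site, and the product stops before its index reaches
  \<open>r\<close>.\<close>

lemma rate_factorial_nonzero:
  assumes "admissible sys" "r \<in> occupations sys"
  shows "rate_factorial (rate sys 0) (rate_slope sys) r \<noteq> 0"
proof -
  have "rate sys i \<noteq> 0" if "i < r" for i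
    using assms that Suc_in_occupations_iff[of sys i] occupations_downward[of r sys "Suc i"]
      occupations_downward[of r sys i] by simp
  then show ?thesis
    unfolding rate_factorial_def rate_affine[symmetric] by simp
qed

section \<open>Particle moves and conservation of the particle number\<close>

lemma move_apply:
  "x \<noteq> y \<Longrightarrow> move \<eta> x y z = (if z = x then \<eta> x - 1 else if z = y then Suc (\<eta> y) else \<eta> z)"
  by (simp add: move_def)

lemma sum_move:
  fixes \<eta> :: "'v::finite \<Rightarrow> nat"
  assumes "x \<noteq> y" "\<eta> x \<noteq> 0"
  shows "sum (move \<eta> x y) UNIV = sum \<eta> UNIV"
proof -
  \<comment> \<open>Adding the removed particle on the left and the inserted one on the right avoids
    truncated subtraction.\<close>
  have "(\<Sum>z\<in>UNIV. move \<eta> x y z + (if z = x then 1 else 0)) = (\<Sum>z\<in>UNIV. \<eta> z + (if z = y then 1 else 0))"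
    using assms by (intro sum.cong) (auto simp: move_apply)
  then show ?thesis
    by (simp add: sum.distrib)
qed

lemma move_in_configurations:
  assumes "admissible sys" "\<eta> \<in> configurations sys" "x \<noteq> y" "rate sys (\<eta> y) \<noteq> 0"
  shows "move \<eta> x y \<in> configurations sys"
  using assms Suc_in_occupations_iff[OF assms(1), of "\<eta> y"] occupations_downward[of "\<eta> x" sys "\<eta> x - 1"]
  by (auto simp: configurations_def move_apply)

text \<open>Jumps from an empty or into a full site have rate 0 and diagonal bonds have weight 0, so
  only \<open>\<eta>\<close> and its admissible neighbours matter.\<close>

lemma generator_cong:
  assumes "admissible sys" "\<And>x. p x x = 0" "\<eta> \<in> configurations sys" "f \<eta> = g \<eta>"
    and moves: "\<And>x y. x \<noteq> y \<Longrightarrow> \<eta> x \<noteq> 0 \<Longrightarrow> move \<eta> x y \<in> configurations sys \<Longrightarrow>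
      f (move \<eta> x y) = g (move \<eta> x y)"
  shows "generator p (rate sys) f \<eta> = generator p (rate sys) g \<eta>"
proof -
  have jump: "real (\<eta> x) * rate sys (\<eta> y) * (f (move \<eta> x y) - f \<eta>) =
      real (\<eta> x) * rate sys (\<eta> y) * (g (move \<eta> x y) - g \<eta>)" if "x \<noteq> y" for x y
    using moves[OF that] move_in_configurations[OF assms(1,3) that] assms(4)
    by (cases "\<eta> x = 0"; cases "rate sys (\<eta> y) = 0") auto
  have "p x y * bond_generator (rate sys) x y f \<eta> = p x y * bond_generator (rate sys) x y g \<eta>" for x y
  proof (cases "x = y")
    case False
    show ?thesis
      unfolding bond_generator_def jump[OF False] jump[OF False[symmetric]] ..
  qed (simp add: assms(2))
  then show ?thesis
    unfolding generator_def by (intro sum.cong refl)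
qed

text \<open>Moves conserve the particle number, and no site can hold more than all \<open>N\<close>
  particles, which gives finiteness.\<close>

lemma closed_class_configurations:
  fixes p :: "'v::finite \<Rightarrow> 'v \<Rightarrow> real"
  assumes "admissible sys" "\<And>x. p x x = 0"
  shows "closed_class (configurations sys) (generator p (rate sys))
    {\<eta> \<in> configurations sys. sum \<eta> UNIV = N}"
proof -
  have "{\<eta> \<in> configurations sys. sum \<eta> UNIV = N} \<subseteq> Pi\<^sub>E UNIV (\<lambda>_::'v. {..N})"
    by (auto intro: member_le_sum)
  then have "finite {\<eta> :: 'v \<Rightarrow> nat. \<eta> \<in> configurations sys \<and> sum \<eta> UNIV = N}"
    by (rule finite_subset) (intro finite_PiE, auto)
  then show ?thesis
    unfolding closed_class_def
    by (auto intro!: generator_cong assms simp: sum_move)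
qed

section \<open>Sufficiency: duality bond by bond\<close>

lemma bond_generator_commute: "bond_generator v x y = bond_generator v y x"
  by (intro ext) (simp add: bond_generator_def)

lemma prod_split_two:
  fixes F :: "'v::finite \<Rightarrow> real"
  assumes "x \<noteq> y"
  shows "prod F UNIV = F x * F y * prod F (UNIV - {x, y})"
proof -
  have "prod F UNIV = F x * prod F (UNIV - {x})"
    by (simp add: prod.remove[of UNIV x])
  also have "prod F (UNIV - {x}) = F y * prod F (UNIV - {x} - {y})"
    using assms by (subst prod.remove[of _ y]) auto
  also have "UNIV - {x} - {y} = UNIV - {x, y}"
    by auto
  finally show ?thesis
    by (simp add: mult.assoc)
qed

text \<open>A bond changes only the factors at \<open>x\<close> and \<open>y\<close>, so the rest of
  the product factors out as \<open>R\<close>. What remains is \<open>bond_invariance\<close>, with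
  its three relations supplied at each of the two sites.\<close>

lemma dual_series_bond_duality:
  fixes \<xi> \<eta> :: "'v::finite \<Rightarrow> nat" and a \<beta> :: real
  assumes "admissible sys" "\<xi> \<in> configurations sys" "\<eta> \<in> configurations sys" "x \<noteq> y"
  defines "q \<equiv> dual_series (rate sys 0) (rate_slope sys) a \<beta>"
  shows "bond_generator (rate sys) x y (\<lambda>\<zeta>. \<Prod>z\<in>UNIV. q (\<zeta> z) (\<eta> z)) \<xi> =
    bond_generator (rate sys) x y (\<lambda>\<zeta>. \<Prod>z\<in>UNIV. q (\<xi> z) (\<zeta> z)) \<eta>"
proof -
  define R where "R = (\<Prod>z\<in>UNIV - {x, y}. q (\<xi> z) (\<eta> z))"
  define c s where "c = rate sys 0" and "s = rate_slope sys"
  have v: "rate sys n = c + s * real n" for n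
    unfolding c_def s_def by (rule rate_affine)
  have left: "(\<Prod>z\<in>UNIV. q (move \<xi> u w z) (\<eta> z)) = q (\<xi> u - 1) (\<eta> u) * q (Suc (\<xi> w)) (\<eta> w) * R"
    and right: "(\<Prod>z\<in>UNIV. q (\<xi> z) (move \<eta> u w z)) = q (\<xi> u) (\<eta> u - 1) * q (\<xi> w) (Suc (\<eta> w)) * R"
    and diag: "(\<Prod>z\<in>UNIV. q (\<xi> z) (\<eta> z)) = q (\<xi> u) (\<eta> u) * q (\<xi> w) (\<eta> w) * R"
    if "{u, w} = {x, y}" for u w
  proof -
    have "u \<noteq> w"
      using that \<open>x \<noteq> y\<close> by auto
    then show "(\<Prod>z\<in>UNIV. q (move \<xi> u w z) (\<eta> z)) = q (\<xi> u - 1) (\<eta> u) * q (Suc (\<xi> w)) (\<eta> w) * R"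
      "(\<Prod>z\<in>UNIV. q (\<xi> z) (move \<eta> u w z)) = q (\<xi> u) (\<eta> u - 1) * q (\<xi> w) (Suc (\<eta> w)) * R"
      "(\<Prod>z\<in>UNIV. q (\<xi> z) (\<eta> z)) = q (\<xi> u) (\<eta> u) * q (\<xi> w) (\<eta> w) * R"
      unfolding R_def that[symmetric] by (simp_all add: prod_split_two[OF \<open>u \<noteq> w\<close>] move_apply)
  qed
  define A B N where "A z = real (\<xi> z) * q (\<xi> z - 1) (\<eta> z)"
    and "B z = (c + s * real (\<xi> z)) * q (Suc (\<xi> z)) (\<eta> z)" and "N z = real (\<xi> z) * q (\<xi> z) (\<eta> z)" for z
  define A' B' N' where "A' z = real (\<eta> z) * q (\<xi> z) (\<eta> z - 1)"
    and "B' z = (c + s * real (\<eta> z)) * q (\<xi> z) (Suc (\<eta> z))" and "N' z = real (\<eta> z) * q (\<xi> z) (\<eta> z)" for z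
  have occ: "\<xi> z \<in> occupations sys" "\<eta> z \<in> occupations sys" for z
    using assms(2,3) by (auto simp: configurations_def)
  have nz: "rate_factorial c s r \<noteq> 0" if "r \<le> n" "n \<in> occupations sys" for r n
    using rate_factorial_nonzero[OF assms(1) occupations_downward[OF that(2,1)]] by (simp add: c_def s_def)
  have 1: "\<beta> * A z = s * A' z - 2 * s * N' z - c * q (\<xi> z) (\<eta> z) + B' z" for z
    using dual_series_lower_left[of "\<xi> z" c s \<beta> a "\<eta> z"] nz occ
    by (simp add: A_def A'_def B'_def N'_def q_def c_def[symmetric] s_def[symmetric] mult.assoc)
  have 2: "\<beta> * A' z = s * a ^ 2 * A z - 2 * s * a * N z - c * a * q (\<xi> z) (\<eta> z) + B z" for z
    using dual_series_lower_right[of "\<eta> z" c s \<beta> a "\<xi> z"] nz occ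
    by (simp add: A_def A'_def B_def N_def q_def c_def[symmetric] s_def[symmetric] mult.assoc)
  have 3: "N z - a * A z = N' z - A' z" for z
    using dual_series_number[of "\<xi> z" c s a \<beta> "\<eta> z"]
    by (simp add: A_def A'_def N_def N'_def q_def c_def[symmetric] s_def[symmetric] mult.assoc)
  have inv: "A x * B y + B x * A y - c * (N x * q (\<xi> y) (\<eta> y) + q (\<xi> x) (\<eta> x) * N y) - 2 * s * N x * N y =
    A' x * B' y + B' x * A' y - c * (N' x * q (\<xi> y) (\<eta> y) + q (\<xi> x) (\<eta> x) * N' y) - 2 * s * N' x * N' y"
    by (rule bond_invariance[OF 1 1 2 2 3 3])
  have "bond_generator (rate sys) x y (\<lambda>\<zeta>. \<Prod>z\<in>UNIV. q (\<zeta> z) (\<eta> z)) \<xi> =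
      (A x * B y + B x * A y - c * (N x * q (\<xi> y) (\<eta> y) + q (\<xi> x) (\<eta> x) * N y) - 2 * s * N x * N y) * R"
    unfolding bond_generator_def left[OF refl] left[OF insert_commute] diag[OF refl] v A_def B_def N_def
    by (simp add: algebra_simps)
  moreover have "bond_generator (rate sys) x y (\<lambda>\<zeta>. \<Prod>z\<in>UNIV. q (\<xi> z) (\<zeta> z)) \<eta> =
      (A' x * B' y + B' x * A' y - c * (N' x * q (\<xi> y) (\<eta> y) + q (\<xi> x) (\<eta> x) * N' y) - 2 * s * N' x * N' y) * R"
    unfolding bond_generator_def right[OF refl] right[OF insert_commute] diag[OF refl] v A'_def B'_def N'_def
    by (simp add: algebra_simps)
  ultimately show ?thesis
    using inv by simp
qed

section \<open>Necessity: test configurations and the recursion for \<open>d\<close>\<close>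

text \<open>The difference of the two sides of the duality relation for a single bond \<open>{x, y}\<close>, when
  \<open>\<xi>\<close> has \<open>k\<close> particles at \<open>x\<close> and none elsewhere, and \<open>\<eta>\<^sub>x = m\<close>, \<open>\<eta>\<^sub>y = n\<close>.\<close>

definition bond_defect :: "(nat \<Rightarrow> real) \<Rightarrow> (nat \<Rightarrow> nat \<Rightarrow> real) \<Rightarrow> nat \<Rightarrow> nat \<Rightarrow> nat \<Rightarrow> real" where
  "bond_defect v d k m n = real k * v 0 * (d (k - 1) m * d 1 n - d k m)
     - (real m * v n * (d k (m - 1) - d k m) + real n * v m * (d k (Suc m) - d k m))"

text \<open>As \<open>d 0\<close> is 1, the product for this \<open>\<xi>\<close> depends on
  \<open>\<zeta> x\<close> only. For a bond away from \<open>x\<close>, the rates vanish on the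
  first side and the function is unchanged on the second.\<close>

lemma single_site_bond:
  fixes x :: "'v::finite" and \<eta> :: "'v \<Rightarrow> nat" and k :: nat and d :: "nat \<Rightarrow> nat \<Rightarrow> real"
  assumes d0: "\<And>n. d 0 n = 1" and "u \<noteq> w"
  defines "\<xi> \<equiv> (\<lambda>_. 0)(x := k)"
  shows "bond_generator v u w (\<lambda>\<zeta>. \<Prod>z\<in>UNIV. d (\<zeta> z) (\<eta> z)) \<xi>
      - bond_generator v u w (\<lambda>\<zeta>. \<Prod>z\<in>UNIV. d (\<xi> z) (\<zeta> z)) \<eta> =
    (if u = x then bond_defect v d k (\<eta> x) (\<eta> w)
     else if w = x then bond_defect v d k (\<eta> x) (\<eta> u) else 0)"
proof -
  have single: "(\<Prod>z\<in>UNIV. d (\<xi> z) (\<zeta> z)) = d k (\<zeta> x)" for \<zeta> :: "'v \<Rightarrow> nat"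
    by (subst prod.remove[of _ x]) (auto simp: \<xi>_def d0 intro!: prod.neutral)
  have at_x: "bond_generator v x y (\<lambda>\<zeta>. \<Prod>z\<in>UNIV. d (\<zeta> z) (\<eta> z)) \<xi>
      - bond_generator v x y (\<lambda>\<zeta>. \<Prod>z\<in>UNIV. d (\<xi> z) (\<zeta> z)) \<eta> = bond_defect v d k (\<eta> x) (\<eta> y)"
    if "x \<noteq> y" for y
  proof -
    have "(\<Prod>z\<in>UNIV - {x, y}. d (move \<xi> x y z) (\<eta> z)) = 1"
      using that by (intro prod.neutral) (auto simp: move_apply \<xi>_def d0)
    then have "(\<Prod>z\<in>UNIV. d (move \<xi> x y z) (\<eta> z)) = d (k - 1) (\<eta> x) * d 1 (\<eta> y)"
      using that by (subst prod_split_two[OF that]) (simp add: move_apply \<xi>_def)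
    then show ?thesis
      using that unfolding bond_generator_def single
      by (simp add: bond_defect_def move_apply \<xi>_def)
  qed
  show ?thesis
  proof (cases "u = x \<or> w = x")
    case True
    then show ?thesis
      using at_x[of w] at_x[of u] \<open>u \<noteq> w\<close> by (auto simp: bond_generator_commute[of v u x])
  next
    case False
    then show ?thesis
      unfolding bond_generator_def single using \<open>u \<noteq> w\<close> by (auto simp: move_apply \<xi>_def)
  qed
qed

text \<open>Only bonds at \<open>x\<close> survive, and each occurs in both orientations, hence the
  weight \<open>p x y + p y x\<close>.\<close>

lemma single_site_generator:
  fixes p :: "'v::finite \<Rightarrow> 'v \<Rightarrow> real" and x :: 'v and k :: nat and d :: "nat \<Rightarrow> nat \<Rightarrow> real"
  assumes d0: "\<And>n. d 0 n = 1" and pxx: "\<And>x. p x x = 0"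
  defines "\<xi> \<equiv> (\<lambda>_. 0)(x := k)"
  shows "generator p v (\<lambda>\<zeta>. \<Prod>z\<in>UNIV. d (\<zeta> z) (\<eta> z)) \<xi>
      - generator p v (\<lambda>\<zeta>. \<Prod>z\<in>UNIV. d (\<xi> z) (\<zeta> z)) \<eta> =
    (\<Sum>y\<in>UNIV. (p x y + p y x) * bond_defect v d k (\<eta> x) (\<eta> y))"
proof -
  let ?\<Delta> = "\<lambda>y. bond_defect v d k (\<eta> x) (\<eta> y)"
  have "generator p v (\<lambda>\<zeta>. \<Prod>z\<in>UNIV. d (\<zeta> z) (\<eta> z)) \<xi>
      - generator p v (\<lambda>\<zeta>. \<Prod>z\<in>UNIV. d (\<xi> z) (\<zeta> z)) \<eta> =
    (\<Sum>u\<in>UNIV. \<Sum>w\<in>UNIV. p u w * (bond_generator v u w (\<lambda>\<zeta>. \<Prod>z\<in>UNIV. d (\<zeta> z) (\<eta> z)) \<xi>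
      - bond_generator v u w (\<lambda>\<zeta>. \<Prod>z\<in>UNIV. d (\<xi> z) (\<zeta> z)) \<eta>))"
    by (simp add: generator_def sum_subtractf right_diff_distrib)
  also have "\<dots> = (\<Sum>u\<in>UNIV. \<Sum>w\<in>UNIV. (if u = x then p x w * ?\<Delta> w else 0) + (if w = x then p u x * ?\<Delta> u else 0))"
  proof (intro sum.cong refl)
    fix u w
    show "p u w * (bond_generator v u w (\<lambda>\<zeta>. \<Prod>z\<in>UNIV. d (\<zeta> z) (\<eta> z)) \<xi>
        - bond_generator v u w (\<lambda>\<zeta>. \<Prod>z\<in>UNIV. d (\<xi> z) (\<zeta> z)) \<eta>) =
      (if u = x then p x w * ?\<Delta> w else 0) + (if w = x then p u x * ?\<Delta> u else 0)"
    proof (cases "u = w")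
      case False
      then show ?thesis
        unfolding \<xi>_def single_site_bond[of d, OF d0 False] by auto
    qed (simp add: pxx)
  qed
  also have "\<dots> = (\<Sum>u\<in>UNIV. if u = x then (\<Sum>w\<in>UNIV. p x w * ?\<Delta> w) else 0) + (\<Sum>u\<in>UNIV. p u x * ?\<Delta> u)"
    unfolding sum.distrib by (intro arg_cong2[of _ _ _ _ "(+)"] sum.cong refl) auto
  also have "\<dots> = (\<Sum>y\<in>UNIV. (p x y + p y x) * ?\<Delta> y)"
    by (simp add: sum.distrib distrib_right)
  finally show ?thesis .
qed

text \<open>A path joining two distinct sites has a first step; its rate is nonzero as a factor of a
  positive product, and its endpoints differ because \<open>p\<close> vanishes on the
  diagonal.\<close>

lemma irreducible_rates_edge:
  fixes p :: "'v::finite \<Rightarrow> 'v \<Rightarrow> real"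
  assumes "CARD('v) \<ge> 2" "\<And>x. p x x = 0" "irreducible_rates p"
  obtains x y where "x \<noteq> y" "p x y \<noteq> 0"
proof -
  have "\<not> CARD('v) \<le> Suc 0"
    using assms(1) by simp
  then obtain x y :: 'v where "x \<noteq> y"
    using card_le_Suc0_iff_eq[of "UNIV :: 'v set"] by auto
  obtain xs where xs: "xs \<noteq> []" "hd xs = x" "last xs = y"
    "(\<Prod>l<length xs - 1. p (xs ! l) (xs ! Suc l)) > 0"
    using assms(3) unfolding irreducible_rates_def by blast
  have "length xs \<noteq> 1"
    using xs \<open>x \<noteq> y\<close> by (auto simp: length_Suc_conv)
  then have "0 < length xs - 1"
    using xs(1) by (cases xs) auto
  moreover have "(\<Prod>l<length xs - 1. p (xs ! l) (xs ! Suc l)) \<noteq> 0"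
    using xs(4) by (rule less_imp_neq[symmetric])
  ultimately have "p (xs ! 0) (xs ! Suc 0) \<noteq> 0"
    by (metis finite_lessThan lessThan_iff prod_zero_iff)
  then show ?thesis
    using that assms(2) by metis
qed

lemma generator_duality_recursion:
  fixes p :: "'v::finite \<Rightarrow> 'v \<Rightarrow> real" and d :: "nat \<Rightarrow> nat \<Rightarrow> real"
  assumes adm: "admissible sys" and d0: "\<And>n. d 0 n = 1"
    and p: "\<And>x y. p x y \<ge> 0" "\<And>x. p x x = 0" and xy: "x \<noteq> y" "p x y \<noteq> 0"
    and dual: "\<And>\<xi> \<eta>. \<xi> \<in> configurations sys \<Longrightarrow> \<eta> \<in> configurations sys \<Longrightarrow>
      generator p (rate sys) (\<lambda>\<zeta>. \<Prod>z\<in>UNIV. d (\<zeta> z) (\<eta> z)) \<xi> =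
      generator p (rate sys) (\<lambda>\<zeta>. \<Prod>z\<in>UNIV. d (\<xi> z) (\<zeta> z)) \<eta>"
    and k: "k \<in> occupations sys"
  shows "k > 0 \<Longrightarrow> d k 0 = d (k - 1) 0 * d 1 0"
    and "m \<in> occupations sys \<Longrightarrow>
      real k * d (k - 1) m * ((d 1 1 - d 1 0) * rate sys 0) =
      rate_slope sys * real m * (d k (m - 1) - d k m) + rate sys m * (d k (Suc m) - d k m)"
proof -
  let ?\<Delta> = "bond_defect (rate sys) d k"
  let ?c = "\<lambda>z. p x z + p z x"
  have zero: "(\<Sum>z\<in>UNIV. ?c z * ?\<Delta> (\<eta> x) (\<eta> z)) = 0" if "\<eta> \<in> configurations sys" for \<eta>
    using single_site_generator[where d = d and p = p and x = x and k = k and v = "rate sys" and \<eta> = \<eta>, OF d0 p(2)]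
      dual[of "(\<lambda>_. 0)(x := k)" \<eta>, OF _ that] k
    by (simp add: configurations_def zero_in_occupations)
  have pos: "?c y > 0"
    using xy(2) p(1)[of x y] p(1)[of y x] by simp
  show "d k 0 = d (k - 1) 0 * d 1 0" if "k > 0"
  proof -
    \<comment> \<open>For empty \<open>\<eta>\<close> all bonds at \<open>x\<close> have the same
      defect, which factors out of a positive total weight.\<close>
    have "(\<Sum>z\<in>UNIV. ?c z) * ?\<Delta> 0 0 = 0"
      using zero[of "\<lambda>_. 0"] by (simp add: configurations_def zero_in_occupations sum_distrib_right)
    moreover have "(\<Sum>z\<in>UNIV. ?c z) > 0"
      using pos p(1) by (intro sum_pos2[of _ y]) auto
    ultimately have "?\<Delta> 0 0 = 0"
      by simp
    then show ?thesis
      using that rate_0_pos[OF adm] by (simp add: bond_defect_def)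
  qed
  show "real k * d (k - 1) m * ((d 1 1 - d 1 0) * rate sys 0) =
      rate_slope sys * real m * (d k (m - 1) - d k m) + rate sys m * (d k (Suc m) - d k m)"
    if m: "m \<in> occupations sys"
  proof -
    let ?\<eta> = "\<lambda>n. (\<lambda>_. 0)(x := m, y := n)"
    \<comment> \<open>Raising \<open>\<eta> y\<close> from 0 to 1 affects only the bond to
      \<open>y\<close>, so the difference isolates it. The slope in the recursion arises as
      \<open>v(1) - v(0)\<close>.\<close>
    have "(\<Sum>z\<in>UNIV. ?c z * ?\<Delta> m (?\<eta> 1 z)) - (\<Sum>z\<in>UNIV. ?c z * ?\<Delta> m (?\<eta> 0 z)) = 0"
      using zero[of "?\<eta> 1"] zero[of "?\<eta> 0"] m xy(1) one_in_occupations[OF adm]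
      by (simp add: configurations_def zero_in_occupations)
    also have "(\<Sum>z\<in>UNIV. ?c z * ?\<Delta> m (?\<eta> 1 z)) - (\<Sum>z\<in>UNIV. ?c z * ?\<Delta> m (?\<eta> 0 z)) =
        (\<Sum>z\<in>UNIV. if z = y then ?c y * (?\<Delta> m 1 - ?\<Delta> m 0) else 0)"
      unfolding sum_subtractf[symmetric] by (intro sum.cong) (auto simp: right_diff_distrib)
    finally have "?\<Delta> m 1 = ?\<Delta> m 0"
      using pos by simp
    then show ?thesis
      using rate_affine[of sys 1] by (simp add: bond_defect_def algebra_simps)
  qed
qed

text \<open>The series obeys the same recursion, and the solution is unique: outer induction on
  \<open>k\<close>, inner strong induction on \<open>n\<close>, since the value at
  \<open>m + 1\<close> uses those at \<open>m\<close> and \<open>m - 1\<close>.\<close>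

lemma recursion_imp_dual_series:
  fixes d :: "nat \<Rightarrow> nat \<Rightarrow> real"
  assumes adm: "admissible sys" and d0: "\<And>n. d 0 n = 1"
    and step0: "\<And>k. k \<in> occupations sys \<Longrightarrow> k > 0 \<Longrightarrow> d k 0 = d (k - 1) 0 * a"
    and step: "\<And>k m. k \<in> occupations sys \<Longrightarrow> m \<in> occupations sys \<Longrightarrow>
      real k * d (k - 1) m * \<beta> =
      rate_slope sys * real m * (d k (m - 1) - d k m) + rate sys m * (d k (Suc m) - d k m)"
    and "k \<in> occupations sys" "n \<in> occupations sys"
  shows "d k n = dual_series (rate sys 0) (rate_slope sys) a \<beta> k n"
  using assms(5,6)
proof (induction k arbitrary: n)
  case 0
  then show ?case by (simp add: d0)
next
  case (Suc k)
  define q where "q = dual_series (rate sys 0) (rate_slope sys) a \<beta>"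
  have k: "k \<in> occupations sys"
    using Suc.prems(1) occupations_downward[of "Suc k" sys k] by simp
  have dk: "d k m = q k m" if "m \<in> occupations sys" for m
    using Suc.IH[OF k that] by (simp add: q_def)
  have rec: "real (Suc k) * q k m * \<beta> =
      rate_slope sys * real m * (q (Suc k) (m - 1) - q (Suc k) m) + rate sys m * (q (Suc k) (Suc m) - q (Suc k) m)" for m
    using dual_series_lower_left[of "Suc k" "rate sys 0" "rate_slope sys" \<beta> a m]
      rate_factorial_nonzero[OF adm occupations_downward[OF Suc.prems(1)]] rate_affine[of sys m]
    by (simp add: q_def algebra_simps)
  show ?case
    unfolding q_def[symmetric] using Suc.prems(2)
  proof (induction n rule: less_induct)
    case (less n)
    show ?case
    proof (cases n)
      case 0
      then show ?thesis
        using step0[OF Suc.prems(1)] dk[of 0] by (simp add: zero_in_occupations q_def)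
    next
      case (Suc m)
      have m: "m \<in> occupations sys" "m - 1 \<in> occupations sys"
        using less.prems Suc occupations_downward[of n sys] by auto
      have "d (Suc k) m = q (Suc k) m" "d (Suc k) (m - 1) = q (Suc k) (m - 1)"
        using less.IH m Suc by auto
      \<comment> \<open>As \<open>Suc m\<close> is still a possible occupation, the recursion can be
        solved for the value there.\<close>
      moreover have "rate sys m \<noteq> 0"
        using Suc_in_occupations_iff[OF adm m(1)] less.prems Suc by simp
      ultimately show ?thesis
        using step[OF Suc.prems(1) m(1)] rec[of m] dk[OF m(1)] Suc by simp
    qed
  qed
qed

section \<open>Closed and hypergeometric forms of the series\<close>

lemma pochhammer_minus_nat: "pochhammer (- real n) r = (-1) ^ r * (real (n choose r) * fact r)"
proof -
  have "real (n choose r) = (-1) ^ r * pochhammer (- real n) r / fact r"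
    using gbinomial_pochhammer[of "real n" r] by (simp add: binomial_gbinomial)
  then show ?thesis
    by (simp add: mult.assoc[symmetric] flip: power_mult_distrib)
qed

text \<open>The power \<open>0 ^ (k - r)\<close> leaves only the top term
  \<open>r = k\<close>.\<close>

lemma dual_series_0:
  "dual_series c s 0 \<beta> k n =
    (if k \<le> n then fact n / fact (n - k) * \<beta> ^ k / rate_factorial c s k else 0)"
proof -
  have "dual_series c s 0 \<beta> k n = (\<Sum>r\<le>k. dual_term c s 0 \<beta> k n r)"
    by (rule dual_series_eq_sum) simp
  also have "\<dots> = (\<Sum>r\<le>k. if r = k then dual_term c s 0 \<beta> k n k else 0)"
    by (intro sum.cong) (auto simp: dual_term_def)
  finally show ?thesis
    by (auto simp: dual_term_def binomial_fact)
qed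

lemma dual_series_nonzero:
  assumes "a \<noteq> 0"
  shows "dual_series c s a \<beta> k n = a ^ k * (\<Sum>r = 0..min k n.
    real (n choose r) * real (k choose r) * fact r / rate_factorial c s r * (\<beta> / a) ^ r)"
  unfolding dual_series_def sum_distrib_left atLeast0AtMost
  using assms by (intro sum.cong) (auto simp: dual_term_def power_divide power_diff field_simps)

lemma rate_factorial_IRW: "rate_factorial 1 0 r = 1"
  by (simp add: rate_factorial_def)

lemma rate_factorial_SIP: "rate_factorial \<alpha> 1 r = pochhammer \<alpha> r"
  by (simp add: rate_factorial_def pochhammer_prod atLeast0LessThan)

lemma rate_factorial_SEP: "rate_factorial \<gamma> (-1) r = (-1) ^ r * pochhammer (- \<gamma>) r"
  by (induction r) (simp_all add: rate_factorial_def pochhammer_Suc algebra_simps)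

text \<open>The values 1, \<open>\<alpha>\<close>, \<open>\<gamma>\<close> of \<open>v(0)\<close>
  explain the parameters \<open>b\<close>, \<open>b \<alpha>\<close>, \<open>b \<gamma>\<close>. The
  signs of \<open>(-n)_r\<close> and \<open>(-k)_r\<close> cancel; in SEP the sign of
  \<open>(-\<gamma>)_r\<close> is compensated by that of the argument.\<close>

lemma duality_polynomial_eq_dual_series:
  assumes "admissible sys" "k \<in> occupations sys" "n \<in> occupations sys"
  shows "duality_polynomial sys a b k n =
    dual_series (rate sys 0) (rate_slope sys) a (b * rate sys 0) k n"
proof (cases "a = 0")
  case True
  show ?thesis
  proof (cases sys)
    case (SIP \<alpha>)
    then have "\<alpha> \<notin> \<int>\<^sub>\<le>\<^sub>0"
      using assms(1) nonpos_Ints_nonpos by fastforce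
    then have "pochhammer \<alpha> k = Gamma (\<alpha> + real k) / Gamma \<alpha>"
      by (rule pochhammer_Gamma)
    then show ?thesis
      using True SIP by (simp add: dual_series_0 rate_factorial_SIP)
  next
    case (SEP \<gamma>)
    then have "k \<le> \<gamma>"
      using assms(2) by simp
    have "rate_factorial (real \<gamma>) (-1) k = real (\<gamma> choose k) * fact k"
      unfolding rate_factorial_SEP pochhammer_minus_nat by (simp flip: power_mult_distrib mult.assoc)
    also have "\<dots> = fact \<gamma> / fact (\<gamma> - k)"
      using \<open>k \<le> \<gamma>\<close> by (simp add: binomial_fact)
    finally show ?thesis
      using True SEP by (simp add: dual_series_0 mult_ac)
  qed (use True in \<open>simp add: dual_series_0 rate_factorial_IRW\<close>)
next
  case False
  show ?thesis
  proof (cases sys)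
    case (SIP \<alpha>)
    then show ?thesis
      using False
      by (auto intro!: sum.cong simp: dual_series_nonzero rate_factorial_SIP hyp2F1_neg_def
          pochhammer_minus_nat minus_one_power_iff)
  next
    case (SEP \<gamma>)
    then show ?thesis
      using False
      by (auto intro!: sum.cong simp: dual_series_nonzero rate_factorial_SEP hyp2F1_neg_def
          pochhammer_minus_nat minus_one_power_iff power_minus[of "b * real \<gamma> / a"])
  qed (use False in \<open>simp add: dual_series_nonzero rate_factorial_IRW\<close>)
qed

theorem mainTheorem2:
  fixes p :: "'v::finite \<Rightarrow> 'v \<Rightarrow> real"
    and sys :: particle_system
    and P :: "real \<Rightarrow> ('v \<Rightarrow> nat) \<Rightarrow> ('v \<Rightarrow> nat) pmf"
    and d :: "nat \<Rightarrow> nat \<Rightarrow> real"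
  assumes "CARD('v) \<ge> 2"
    and "\<And>x y. p x y \<ge> 0"
    and "\<And>x. p x x = 0"
    and "irreducible_rates p"
    and "admissible sys"
    and "markov_process (configurations sys) (generator p (rate sys)) P"
    and "\<And>n. n \<in> occupations sys \<Longrightarrow> d 0 n = 1"
  shows "self_duality_function (configurations sys) P (\<lambda>\<xi> \<eta>. \<Prod>x\<in>UNIV. d (\<xi> x) (\<eta> x)) \<longleftrightarrow>
    (\<exists>a b. \<forall>k\<in>occupations sys. \<forall>n\<in>occupations sys. d k n = duality_polynomial sys a b k n)"
proof -
  let ?S = "configurations sys" and ?E = "occupations sys" and ?L = "generator p (rate sys)"
  define dual where "dual e \<longleftrightarrow> (\<forall>\<xi>\<in>?S. \<forall>\<eta>\<in>?S.
      ?L (\<lambda>\<zeta>. \<Prod>x\<in>UNIV. e (\<zeta> x) (\<eta> x)) \<xi> = ?L (\<lambda>\<zeta>. \<Prod>x\<in>UNIV. e (\<xi> x) (\<zeta> x)) \<eta>)"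
    for e :: "nat \<Rightarrow> nat \<Rightarrow> real"
  have gen: "self_duality_function ?S P (\<lambda>\<xi> \<eta>. \<Prod>x\<in>UNIV. d (\<xi> x) (\<eta> x)) \<longleftrightarrow> dual d"
    unfolding dual_def
  proof (rule self_duality_iff_generator_duality[OF assms(6)])
    fix \<xi> :: "'v \<Rightarrow> nat" assume "\<xi> \<in> ?S"
    then show "\<exists>C. \<xi> \<in> C \<and> closed_class ?S ?L C"
      by (intro exI[of _ "{\<eta> \<in> ?S. sum \<eta> UNIV = sum \<xi> UNIV}"] conjI
          closed_class_configurations assms(3,5)) simp
  qed
  \<comment> \<open>Duality sees the local function only on \<open>?E\<close>, so it may be altered
    elsewhere and later exchanged for the series.\<close>
  have cong: "dual e \<longleftrightarrow> dual e'" if e: "\<And>k n. k \<in> ?E \<Longrightarrow> n \<in> ?E \<Longrightarrow> e k n = e' k n" for e e'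
  proof -
    have D: "(\<Prod>x\<in>UNIV. e (\<xi> x) (\<eta> x)) = (\<Prod>x\<in>UNIV. e' (\<xi> x) (\<eta> x))"
      if "\<xi> \<in> ?S" "\<eta> \<in> ?S" for \<xi> \<eta> :: "'v \<Rightarrow> nat"
      using that by (intro prod.cong refl e) (auto simp: configurations_def)
    have "?L (\<lambda>\<zeta>. \<Prod>x\<in>UNIV. e (\<zeta> x) (\<eta> x)) \<xi> = ?L (\<lambda>\<zeta>. \<Prod>x\<in>UNIV. e' (\<zeta> x) (\<eta> x)) \<xi>"
      "?L (\<lambda>\<zeta>. \<Prod>x\<in>UNIV. e (\<xi> x) (\<zeta> x)) \<eta> = ?L (\<lambda>\<zeta>. \<Prod>x\<in>UNIV. e' (\<xi> x) (\<zeta> x)) \<eta>"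
      if "\<xi> \<in> ?S" "\<eta> \<in> ?S" for \<xi> \<eta>
      using that by (auto intro!: generator_cong assms(3,5) D)
    then show ?thesis
      unfolding dual_def by (intro ball_cong refl) (simp only:)
  qed
  show ?thesis
    unfolding gen
  proof
    assume "dual d"
    \<comment> \<open>The normalization of \<open>d 0\<close> is given on \<open>?E\<close> only,
      whereas the recursion uses it at every \<open>n\<close>.\<close>
    define e where "e k n = (if k = 0 then 1 else d k n)" for k n
    have eq: "e k n = d k n" if "n \<in> ?E" for k n
      using assms(7)[OF that] by (simp add: e_def)
    have e0: "e 0 n = 1" for n
      by (simp add: e_def)
    have "dual e"
      using \<open>dual d\<close> cong[of e d] eq by simp
    then have dual_e: "?L (\<lambda>\<zeta>. \<Prod>z\<in>UNIV. e (\<zeta> z) (\<eta> z)) \<xi> = ?L (\<lambda>\<zeta>. \<Prod>z\<in>UNIV. e (\<xi> z) (\<zeta> z)) \<eta>"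
      if "\<xi> \<in> ?S" "\<eta> \<in> ?S" for \<xi> \<eta>
      using that unfolding dual_def by blast
    obtain x y where xy: "x \<noteq> y" "p x y \<noteq> 0"
      using irreducible_rates_edge[OF assms(1,3,4)] .
    \<comment> \<open>These choices are forced: the series equals \<open>a\<close> at
      \<open>(1, 0)\<close> and \<open>a + b\<close> at \<open>(1, 1)\<close>.\<close>
    define a b where "a = e 1 0" and "b = e 1 1 - e 1 0"
    have "e k n = dual_series (rate sys 0) (rate_slope sys) a (b * rate sys 0) k n" if "k \<in> ?E" "n \<in> ?E" for k n
    proof (rule recursion_imp_dual_series[where d = e, OF assms(5) e0 _ _ that])
      show "e k 0 = e (k - 1) 0 * a" if "k \<in> ?E" "k > 0" for k
        unfolding a_def
        by (rule generator_duality_recursion(1)[where d = e, OF assms(5) e0 assms(2,3) xy dual_e that])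
      show "real k * e (k - 1) m * (b * rate sys 0) =
          rate_slope sys * real m * (e k (m - 1) - e k m) + rate sys m * (e k (Suc m) - e k m)"
        if "k \<in> ?E" "m \<in> ?E" for k m
        unfolding b_def
        by (rule generator_duality_recursion(2)[where d = e, OF assms(5) e0 assms(2,3) xy dual_e that])
    qed
    then show "\<exists>a b. \<forall>k\<in>?E. \<forall>n\<in>?E. d k n = duality_polynomial sys a b k n"
      using eq duality_polynomial_eq_dual_series[OF assms(5)] by metis
  next
    assume "\<exists>a b. \<forall>k\<in>?E. \<forall>n\<in>?E. d k n = duality_polynomial sys a b k n"
    then obtain a b where d: "d k n = duality_polynomial sys a b k n" if "k \<in> ?E" "n \<in> ?E" for k n
      by blast
    let ?q = "dual_series (rate sys 0) (rate_slope sys) a (b * rate sys 0)"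
    have "dual ?q"
      unfolding dual_def generator_def
    proof (intro ballI sum.cong refl)
      fix \<xi> \<eta> :: "'v \<Rightarrow> nat" and x y :: 'v
      assume *: "\<xi> \<in> ?S" "\<eta> \<in> ?S"
      show "p x y * bond_generator (rate sys) x y (\<lambda>\<zeta>. \<Prod>x\<in>UNIV. ?q (\<zeta> x) (\<eta> x)) \<xi> =
          p x y * bond_generator (rate sys) x y (\<lambda>\<zeta>. \<Prod>x\<in>UNIV. ?q (\<xi> x) (\<zeta> x)) \<eta>"
      proof (cases "x = y")
        case False
        then show ?thesis
          by (intro arg_cong2[where f = "(*)"] refl dual_series_bond_duality[OF assms(5) *])
      qed (simp add: assms(3))
    qed
    moreover have "dual d \<longleftrightarrow> dual ?q"
      by (rule cong) (simp add: d duality_polynomial_eq_dual_series[OF assms(5)])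
    ultimately show "dual d"
      by simp
  qed
qed

end
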